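(* Let $C,\gamma>0$. There exist constants $C_{\rm LU}>0$ and $p>2$ (depending only on $C,\gamma$) such that for all $n,m\in\mathbb{N}$, every block structure $0=n_0<n_1<\dots<n_m=n$ and every $M\in\mathbb{R}^{n\times n}$ with $\|M\|_{S_\infty}\le C$ and $\max_{0\le j\le m-1}\|(M[j])^{-1}\|_{S_\infty}\le1/\gamma$, $M$ has a normalized block-$LU$-factorization $M=LU$ satisfying $$\|L\|_{S_\infty}+\|U\|_{S_\infty}+\|L^{-1}\|_{S_\infty}+\|U^{-1}\|_{S_\infty}\le C_{\rm LU}\,m^{1/p}.$$
   Context: Block $(i,j)$, $0\le i,j\le m-1$, consists of rows $n_i+1..n_{i+1}$ and columns $n_j+1..n_{j+1}$. $M[j]:=M(0{:}j,0{:}j)\in\mathbb{R}^{n_{j+1}\times n_{j+1}}$ is the restriction of $M$ to the first $j+1$ block rows and block columns. A normalized block-$LU$-factorization is $M=LU$ with $L$ block lower triangular with identity diagonal blocks ($L(i,j)=0$ for $j>i$, $L(i,i)=I$) and $U$ block upper triangular ($U(j,i)=0$ for $j>i$). $\|\cdot\|_{S_\infty}$ is the spectral norm. *)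

theory Defs
  imports "Jordan_Normal_Form.Matrix"
begin

definition vec_norm2 :: "real vec \<Rightarrow> real" where
  "vec_norm2 x = sqrt (\<Sum>i<dim_vec x. (x $ i)^2)"

definition spec_norm :: "real mat \<Rightarrow> real" where
  "spec_norm A = (SUP x \<in> {x \<in> carrier_vec (dim_col A). vec_norm2 x \<le> 1}. vec_norm2 (A *\<^sub>v x))"

definition block_structure :: "nat \<Rightarrow> nat \<Rightarrow> (nat \<Rightarrow> nat) \<Rightarrow> bool" where
  "block_structure n m ns \<longleftrightarrow> ns 0 = 0 \<and> ns m = n \<and> (\<forall>j<m. ns j < ns (Suc j))"

definition lead_block :: "(nat \<Rightarrow> nat) \<Rightarrow> real mat \<Rightarrow> nat \<Rightarrow> real mat" where
  "lead_block ns M j = mat (ns (Suc j)) (ns (Suc j)) (\<lambda>(i,k). M $$ (i,k))"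

definition in_block :: "(nat \<Rightarrow> nat) \<Rightarrow> nat \<Rightarrow> nat \<Rightarrow> bool" where
  "in_block ns a i \<longleftrightarrow> ns a \<le> i \<and> i < ns (Suc a)"

definition unit_block_lower :: "nat \<Rightarrow> (nat \<Rightarrow> nat) \<Rightarrow> real mat \<Rightarrow> bool" where
  "unit_block_lower m ns L \<longleftrightarrow>
     (\<forall>a<m. \<forall>b<m. \<forall>i k. in_block ns a i \<and> in_block ns b k \<longrightarrow>
        (a < b \<longrightarrow> L $$ (i,k) = 0) \<and> (a = b \<longrightarrow> L $$ (i,k) = (if i = k then 1 else 0)))"

definition block_upper :: "nat \<Rightarrow> (nat \<Rightarrow> nat) \<Rightarrow> real mat \<Rightarrow> bool" where
  "block_upper m ns U \<longleftrightarrow>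
     (\<forall>a<m. \<forall>b<m. \<forall>i k. in_block ns a i \<and> in_block ns b k \<longrightarrow> (b < a \<longrightarrow> U $$ (i,k) = 0))"

definition is_inverse :: "nat \<Rightarrow> real mat \<Rightarrow> real mat \<Rightarrow> bool" where
  "is_inverse n A B \<longleftrightarrow> A \<in> carrier_mat n n \<and> B \<in> carrier_mat n n \<and> A * B = 1\<^sub>m n \<and> B * A = 1\<^sub>m n"

end

theory Submission
  imports Defs "HOL-Analysis.L2_Norm" "Jordan_Normal_Form.Determinant"
begin

text \<open>
  Block column \<open>j\<close> of \<open>U\<^sup>-\<^sup>1\<close> solves a linear system with the matrix \<open>M[j]\<close>, and block row \<open>i\<close> of
  \<open>L\<^sup>-\<^sup>1\<close> below the diagonal solves one with the transpose of \<open>M[i-1]\<close>. Contracting every block with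
  a unit vector leaves a staircase family of \<open>m\<close> such systems, \<open>P (N A\<^sup>T) = P F\<close>, where \<open>P\<close>
  truncates row \<open>i\<close> to the columns of its leading block. Solving each row by itself bounds \<open>N\<close>
  in the Frobenius norm by a multiple of \<open>m\<^bsup>1/2\<^esup>\<close>.

  The gain over the exponent \<open>1/2\<close> comes from comparing the Schatten norms \<open>S\<^sub>2\<close> and \<open>S\<^sub>4\<close>. The
  Richardson iteration for the normal equations, \<open>N \<mapsto> N - C\<^sup>-\<^sup>2 P (P (N A\<^sup>T) A)\<close>, contracts by
  a factor \<open>q < 1\<close> in \<open>S\<^sub>2\<close> and expands by at most \<open>3\<close> in \<open>S\<^sub>4\<close>, because \<open>P\<close> is bounded on
  \<open>S\<^sub>4\<close>. The contracted right-hand side has \<open>S\<^sub>4\<close> norm of order \<open>m\<^bsup>1/4\<^esup>\<close> only, so after \<open>j\<close> steps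
  the spectral norm of \<open>N\<close> is at most a multiple of \<open>3\<^sup>j m\<^bsup>1/4\<^esup> + q\<^sup>j m\<^bsup>1/2\<^esup>\<close>, and a suitable
  \<open>j\<close> proportional to \<open>ln m\<close> makes this \<open>O(m\<^sup>e)\<close> with \<open>e < 1/2\<close>.
\<close>

section \<open>Frobenius and Schatten-4 norms\<close>

text \<open>Any upper bound \<open>c\<close> is accepted, so no supremum has to be handled. For
  empty \<open>J\<close> even a negative \<open>c\<close> qualifies, which is why
  \<open>0 \<le> c\<close> appears separately in several lemmas.\<close>

definition op_bound :: "'a set \<Rightarrow> 'b set \<Rightarrow> ('a \<Rightarrow> 'b \<Rightarrow> real) \<Rightarrow> real \<Rightarrow> bool" where
  "op_bound I J A c \<longleftrightarrow> (\<forall>x. L2_set (\<lambda>i. \<Sum>j\<in>J. A i j * x j) I \<le> c * L2_set x J)"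

definition frob :: "'a set \<Rightarrow> 'b set \<Rightarrow> ('a \<Rightarrow> 'b \<Rightarrow> real) \<Rightarrow> real" where
  "frob I J A = L2_set (\<lambda>i. L2_set (A i) J) I"

text \<open>This is \<open>A B^T\<close>: a Gram matrix if \<open>A = B\<close>, and in general the
  result of applying \<open>B\<close> to every row of \<open>A\<close>.\<close>

definition prodT :: "'b set \<Rightarrow> ('a \<Rightarrow> 'b \<Rightarrow> real) \<Rightarrow> ('c \<Rightarrow> 'b \<Rightarrow> real) \<Rightarrow> 'a \<Rightarrow> 'c \<Rightarrow> real" where
  "prodT J A B i k = (\<Sum>l\<in>J. A i l * B k l)"

definition transposed :: "('a \<Rightarrow> 'b \<Rightarrow> real) \<Rightarrow> 'b \<Rightarrow> 'a \<Rightarrow> real" where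
  "transposed A j i = A i j"

text \<open>The Schatten-4 norm, as \<open>tr ((A A\<^sup>T)\<^sup>2)\<^bsup>1/4\<^esup>\<close>.\<close>

definition s4_norm :: "'a set \<Rightarrow> 'b set \<Rightarrow> ('a \<Rightarrow> 'b \<Rightarrow> real) \<Rightarrow> real" where
  "s4_norm I J A = sqrt (frob I I (prodT J A A))"

definition trunc_rows :: "('a \<Rightarrow> 'b set) \<Rightarrow> ('a \<Rightarrow> 'b \<Rightarrow> real) \<Rightarrow> 'a \<Rightarrow> 'b \<Rightarrow> real" where
  "trunc_rows S A i l = (if l \<in> S i then A i l else 0)"

lemma L2_set_power2: "(L2_set f I)\<^sup>2 = (\<Sum>i\<in>I. (f i)\<^sup>2)"
  by (simp add: L2_set_def sum_nonneg)

lemma L2_set_abs_mono: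
  assumes "\<And>i. i \<in> I \<Longrightarrow> \<bar>f i\<bar> \<le> \<bar>g i\<bar>"
  shows "L2_set f I \<le> L2_set g I"
  unfolding L2_set_def
  by (rule real_sqrt_le_mono, rule sum_mono) (use assms abs_le_square_iff in blast)

lemma inner_le_L2_set: "(\<Sum>i\<in>I. f i * g i) \<le> L2_set f I * L2_set g I"
proof -
  have "(\<Sum>i\<in>I. f i * g i) \<le> (\<Sum>i\<in>I. \<bar>f i\<bar> * \<bar>g i\<bar>)"
    by (rule sum_mono) (metis abs_ge_self abs_mult)
  also have "\<dots> \<le> L2_set f I * L2_set g I" by (rule L2_set_mult_ineq)
  finally show ?thesis .
qed

lemma L2_set_scale: "L2_set (\<lambda>i. c * f i) I = \<bar>c\<bar> * L2_set f I"
  by (simp add: L2_set_def power_mult_distrib sum_distrib_left[symmetric] real_sqrt_mult)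

lemma sum_rotate:
  "(\<Sum>a\<in>A. \<Sum>b\<in>B. \<Sum>c\<in>C. f a b c) = (\<Sum>b\<in>B. \<Sum>c\<in>C. \<Sum>a\<in>A. f a b c)"
proof -
  have "(\<Sum>a\<in>A. \<Sum>b\<in>B. \<Sum>c\<in>C. f a b c) = (\<Sum>b\<in>B. \<Sum>a\<in>A. \<Sum>c\<in>C. f a b c)"
    by (rule sum.swap)
  also have "\<dots> = (\<Sum>b\<in>B. \<Sum>c\<in>C. \<Sum>a\<in>A. f a b c)"
    by (intro sum.cong refl sum.swap)
  finally show ?thesis .
qed

lemma frob_nonneg: "0 \<le> frob I J A"
  by (simp add: frob_def)

lemma s4_norm_nonneg: "0 \<le> s4_norm I J A"
  by (simp add: s4_norm_def frob_nonneg)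

lemma s4_norm_power2: "(s4_norm I J A)\<^sup>2 = frob I I (prodT J A A)"
  by (simp add: s4_norm_def frob_nonneg)

lemma frob_power2: "(frob I J A)\<^sup>2 = (\<Sum>i\<in>I. \<Sum>j\<in>J. (A i j)\<^sup>2)"
  by (simp add: frob_def L2_set_power2)

lemma frob_triangle: "frob I J (\<lambda>i j. A i j + B i j) \<le> frob I J A + frob I J B"
proof -
  have "frob I J (\<lambda>i j. A i j + B i j) \<le> L2_set (\<lambda>i. L2_set (A i) J + L2_set (B i) J) I"
    unfolding frob_def by (rule L2_set_mono) (auto intro: L2_set_triangle_ineq)
  also have "\<dots> \<le> frob I J A + frob I J B"
    unfolding frob_def by (rule L2_set_triangle_ineq)
  finally show ?thesis .
qed

lemma frob_scale: "frob I J (\<lambda>i j. c * A i j) = \<bar>c\<bar> * frob I J A"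
  by (simp add: frob_def L2_set_scale)

lemma frob_transposed: "frob J I (transposed A) = frob I J A"
proof (rule power2_eq_imp_eq)
  show "(frob J I (transposed A))\<^sup>2 = (frob I J A)\<^sup>2"
    by (simp add: frob_power2 transposed_def) (rule sum.swap)
qed (auto simp: frob_nonneg)

lemma frob_abs_mono:
  assumes "\<And>i j. i \<in> I \<Longrightarrow> j \<in> J \<Longrightarrow> \<bar>A i j\<bar> \<le> \<bar>B i j\<bar>"
  shows "frob I J A \<le> frob I J B"
  unfolding frob_def by (intro L2_set_mono L2_set_abs_mono) (auto simp: assms)

lemma op_bound_frob: "op_bound I J A (frob I J A)"
  unfolding op_bound_def
proof
  fix x
  have "L2_set (\<lambda>i. \<Sum>j\<in>J. A i j * x j) I \<le> L2_set (\<lambda>i. L2_set x J * L2_set (A i) J) I"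
  proof (rule L2_set_abs_mono)
    fix i
    have "\<bar>\<Sum>j\<in>J. A i j * x j\<bar> \<le> (\<Sum>j\<in>J. \<bar>A i j\<bar> * \<bar>x j\<bar>)"
      by (metis (no_types, lifting) abs_mult sum.cong sum_abs)
    also have "\<dots> \<le> L2_set (A i) J * L2_set x J" by (rule L2_set_mult_ineq)
    finally show "\<bar>\<Sum>j\<in>J. A i j * x j\<bar> \<le> \<bar>L2_set x J * L2_set (A i) J\<bar>"
      by (simp add: mult.commute)
  qed
  also have "\<dots> = frob I J A * L2_set x J"
    by (simp add: L2_set_scale frob_def)
  finally show "L2_set (\<lambda>i. \<Sum>j\<in>J. A i j * x j) I \<le> frob I J A * L2_set x J" .
qed

text \<open>Duality: \<open>z = A^T y\<close> satisfies
  \<open>|z|^2 = <y, A z> \<le> c |y| |z|\<close>, and one factor \<open>|z|\<close>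
  cancels.\<close>

lemma op_bound_transposed:
  assumes "op_bound I J A c" "0 \<le> c"
  shows "op_bound J I (transposed A) c"
  unfolding op_bound_def
proof
  fix y :: "'a \<Rightarrow> real"
  define z where "z j = (\<Sum>i\<in>I. transposed A j i * y i)" for j
  have "(L2_set z J)\<^sup>2 = (\<Sum>j\<in>J. \<Sum>i\<in>I. y i * (A i j * z j))"
    unfolding L2_set_power2
  proof (rule sum.cong)
    fix j
    have "(z j)\<^sup>2 = (\<Sum>i\<in>I. A i j * y i) * z j"
      by (simp add: power2_eq_square z_def transposed_def)
    also have "\<dots> = (\<Sum>i\<in>I. y i * (A i j * z j))"
      by (simp add: sum_distrib_right sum_distrib_left mult_ac)
    finally show "(z j)\<^sup>2 = (\<Sum>i\<in>I. y i * (A i j * z j))" .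
  qed simp
  also have "\<dots> = (\<Sum>i\<in>I. y i * (\<Sum>j\<in>J. A i j * z j))"
    by (subst sum.swap) (simp add: sum_distrib_left)
  also have "\<dots> \<le> L2_set y I * L2_set (\<lambda>i. \<Sum>j\<in>J. A i j * z j) I"
    by (rule inner_le_L2_set)
  also have "\<dots> \<le> L2_set y I * (c * L2_set z J)"
    using assms by (intro mult_left_mono) (auto simp: op_bound_def)
  finally have *: "L2_set z J * L2_set z J \<le> (c * L2_set y I) * L2_set z J"
    by (simp add: power2_eq_square mult_ac)
  have "L2_set z J \<le> c * L2_set y I"
  proof (cases "L2_set z J = 0")
    case True
    thus ?thesis using assms(2) by simp
  next
    case False
    hence "L2_set z J > 0" using L2_set_nonneg[of z J] by linarith
    with * show ?thesis by simp
  qed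
  thus "L2_set (\<lambda>j. \<Sum>i\<in>I. transposed A j i * y i) J \<le> c * L2_set y I"
    by (simp add: z_def[abs_def])
qed


lemma frob_prodT_le:
  assumes "op_bound K J A c" "0 \<le> c"
  shows "frob I K (prodT J N A) \<le> c * frob I J N"
proof -
  have "frob I K (prodT J N A) \<le> L2_set (\<lambda>i. c * L2_set (N i) J) I"
    unfolding frob_def
  proof (rule L2_set_mono)
    fix i
    have "L2_set (\<lambda>k. \<Sum>l\<in>J. A k l * N i l) K \<le> c * L2_set (N i) J"
      using assms by (simp add: op_bound_def)
    thus "L2_set (prodT J N A i) K \<le> c * L2_set (N i) J"
      by (simp add: prodT_def[abs_def] mult.commute[of "N i _"])
  qed simp
  also have "\<dots> = c * frob I J N"
    using assms by (simp add: L2_set_scale frob_def)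
  finally show ?thesis .
qed

text \<open>Cyclicity of the trace, \<open>tr (A B^T B A^T) = tr ((A^T A) (B^T B))\<close>, moves
  both Gram matrices to the common index set \<open>J\<close>.\<close>

lemma frob_prodT_power2:
  "(frob I K (prodT J A B))\<^sup>2 =
     (\<Sum>l\<in>J. \<Sum>l'\<in>J. prodT I (transposed A) (transposed A) l l' * prodT K (transposed B) (transposed B) l l')"
    (is "_ = ?R")
proof -
  have "(frob I K (prodT J A B))\<^sup>2 =
      (\<Sum>i\<in>I. \<Sum>k\<in>K. \<Sum>l\<in>J. \<Sum>l'\<in>J. (A i l * A i l') * (B k l * B k l'))"
    unfolding frob_power2 unfolding prodT_def power2_eq_square sum_product by (simp add: mult_ac)
  also have "\<dots> = (\<Sum>i\<in>I. \<Sum>l\<in>J. \<Sum>l'\<in>J. \<Sum>k\<in>K. (A i l * A i l') * (B k l * B k l'))"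
    by (intro sum.cong refl sum_rotate)
  also have "\<dots> = (\<Sum>l\<in>J. \<Sum>l'\<in>J. \<Sum>i\<in>I. \<Sum>k\<in>K. (A i l * A i l') * (B k l * B k l'))"
    by (rule sum_rotate)
  also have "\<dots> = ?R"
    by (simp add: prodT_def transposed_def sum_product)
  finally show ?thesis .
qed

text \<open>The preceding trace identity with \<open>B = A\<close>. The Schatten-4 norm may thus be
  computed from \<open>A A^T\<close> or from \<open>A^T A\<close>.\<close>

lemma frob_gram_transposed:
  "frob J J (prodT I (transposed A) (transposed A)) = frob I I (prodT J A A)"
proof (rule power2_eq_imp_eq)
  show "(frob J J (prodT I (transposed A) (transposed A)))\<^sup>2 = (frob I I (prodT J A A))\<^sup>2"
    unfolding frob_prodT_power2[of I I J A A] frob_power2[of J J] by (simp add: power2_eq_square)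
qed (simp_all add: frob_nonneg)

lemma inner_le_frob: "(\<Sum>i\<in>I. \<Sum>j\<in>J. A i j * B i j) \<le> frob I J A * frob I J B"
proof -
  have "(\<Sum>i\<in>I. \<Sum>j\<in>J. A i j * B i j) \<le> (\<Sum>i\<in>I. L2_set (A i) J * L2_set (B i) J)"
    by (intro sum_mono inner_le_L2_set)
  also have "\<dots> \<le> frob I J A * frob I J B"
    unfolding frob_def by (rule inner_le_L2_set)
  finally show ?thesis .
qed

text \<open>A Hoelder inequality for Schatten norms: it is Cauchy-Schwarz for the trace inner
  product of \<open>A^T A\<close> and \<open>B^T B\<close>.\<close>

lemma frob_prodT_le_s4_norm: "frob I K (prodT J A B) \<le> s4_norm I J A * s4_norm K J B"
proof (rule power2_le_imp_le)
  show "(frob I K (prodT J A B))\<^sup>2 \<le> (s4_norm I J A * s4_norm K J B)\<^sup>2"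
    using inner_le_frob[where I = J and J = J and A = "prodT I (transposed A) (transposed A)"
        and B = "prodT K (transposed B) (transposed B)"]
    unfolding frob_prodT_power2 power_mult_distrib s4_norm_power2 frob_gram_transposed .
qed (simp add: s4_norm_nonneg)

text \<open>The Gram matrix of a sum has four terms. The Hoelder bound controls the two mixed ones,
  so the estimates add up to the square of the sum.\<close>

lemma s4_norm_triangle: "s4_norm I J (\<lambda>i j. A i j + B i j) \<le> s4_norm I J A + s4_norm I J B"
proof (rule power2_le_imp_le)
  have "prodT J (\<lambda>i j. A i j + B i j) (\<lambda>i j. A i j + B i j) =
     (\<lambda>i k. (prodT J A A i k + prodT J A B i k) + (prodT J B A i k + prodT J B B i k))"
    by (intro ext) (simp add: prodT_def algebra_simps sum.distrib)
  hence "(s4_norm I J (\<lambda>i j. A i j + B i j))\<^sup>2 =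
      frob I I (\<lambda>i k. (prodT J A A i k + prodT J A B i k) + (prodT J B A i k + prodT J B B i k))"
    by (simp add: s4_norm_power2)
  also have "\<dots> \<le> (frob I I (prodT J A A) + frob I I (prodT J A B)) +
      (frob I I (prodT J B A) + frob I I (prodT J B B))"
    by (rule order_trans[OF frob_triangle]) (intro add_mono frob_triangle)
  also have "\<dots> \<le> (s4_norm I J A * s4_norm I J A + s4_norm I J A * s4_norm I J B) +
      (s4_norm I J B * s4_norm I J A + s4_norm I J B * s4_norm I J B)"
    by (intro add_mono frob_prodT_le_s4_norm)
  also have "\<dots> = (s4_norm I J A + s4_norm I J B)\<^sup>2"
    by (simp add: power2_eq_square algebra_simps)
  finally show "(s4_norm I J (\<lambda>i j. A i j + B i j))\<^sup>2 \<le> (s4_norm I J A + s4_norm I J B)\<^sup>2" .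
qed (simp add: s4_norm_nonneg)

lemma s4_norm_scale: "s4_norm I J (\<lambda>i j. c * A i j) = \<bar>c\<bar> * s4_norm I J A"
proof -
  have "prodT J (\<lambda>i j. c * A i j) (\<lambda>i j. c * A i j) = (\<lambda>i k. c\<^sup>2 * prodT J A A i k)"
    by (intro ext) (simp add: prodT_def sum_distrib_left power2_eq_square mult_ac)
  thus ?thesis
    by (simp add: s4_norm_def frob_scale real_sqrt_mult)
qed

text \<open>The column-side Gram matrix of \<open>N A^T\<close> is \<open>A W A^T\<close> with
  \<open>W = N^T N\<close>, so the Frobenius estimate, used once on each side of \<open>W\<close>,
  yields the factor \<open>c^2\<close>.\<close>

lemma s4_norm_prodT_le:
  assumes "op_bound K J A c" "0 \<le> c"
  shows "s4_norm I K (prodT J N A) \<le> c * s4_norm I J N"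
proof (rule power2_le_imp_le)
  define W where "W = prodT I (transposed N) (transposed N)"
  have "prodT I (transposed (prodT J N A)) (transposed (prodT J N A)) = prodT J (transposed (prodT J W A)) A"
  proof (intro ext)
    fix k k'
    have "prodT I (transposed (prodT J N A)) (transposed (prodT J N A)) k k' =
        (\<Sum>i\<in>I. \<Sum>l'\<in>J. \<Sum>l\<in>J. N i l * A k l * (N i l' * A k' l'))"
      by (simp add: prodT_def transposed_def sum_product) (subst sum.swap, rule refl)
    also have "\<dots> = (\<Sum>l'\<in>J. \<Sum>l\<in>J. \<Sum>i\<in>I. N i l * A k l * (N i l' * A k' l'))"
      by (rule sum_rotate)
    also have "\<dots> = prodT J (transposed (prodT J W A)) A k k'"
      by (simp add: prodT_def transposed_def W_def sum_distrib_left sum_distrib_right mult_ac)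
    finally show "prodT I (transposed (prodT J N A)) (transposed (prodT J N A)) k k' =
       prodT J (transposed (prodT J W A)) A k k'" .
  qed
  hence "(s4_norm I K (prodT J N A))\<^sup>2 = frob K K (prodT J (transposed (prodT J W A)) A)"
    by (simp add: s4_norm_power2 frob_gram_transposed[symmetric, of I])
  also have "\<dots> \<le> c * frob K J (transposed (prodT J W A))"
    by (rule frob_prodT_le[OF assms])
  also have "\<dots> \<le> c * (c * frob J J W)"
    unfolding frob_transposed by (intro mult_left_mono frob_prodT_le assms)
  also have "\<dots> = (c * s4_norm I J N)\<^sup>2"
    unfolding power_mult_distrib s4_norm_power2 W_def frob_gram_transposed by (simp add: power2_eq_square)
  finally show "(s4_norm I K (prodT J N A))\<^sup>2 \<le> (c * s4_norm I J N)\<^sup>2" .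
qed (simp add: s4_norm_nonneg assms)

text \<open>
  With \<open>L\<close> the truncation of \<open>A\<close>, the entry \<open>(i, k)\<close> of \<open>L L\<^sup>T\<close> only involves the smaller of the sets
  \<open>S i\<close>, \<open>S k\<close>, so it is an entry of \<open>A L\<^sup>T\<close> or of its transpose. Hence \<open>\<parallel>L\<parallel>\<^sup>4 \<le> 2 \<parallel>A\<parallel>\<^sup>2 \<parallel>L\<parallel>\<^sup>2\<close> in \<open>S\<^sub>4\<close>.
\<close>

lemma s4_norm_trunc_rows_le:
  assumes chain: "\<And>i k. i \<in> I \<Longrightarrow> k \<in> I \<Longrightarrow> S i \<subseteq> S k \<or> S k \<subseteq> S i"
  shows "s4_norm I J (trunc_rows S A) \<le> sqrt 2 * s4_norm I J A"
proof -
  define L where "L = trunc_rows S A"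
  define E where "E = prodT J A L"
  have "(s4_norm I J L)\<^sup>2 * (s4_norm I J L)\<^sup>2 = (frob I I (prodT J L L))\<^sup>2"
    unfolding s4_norm_power2 by (simp add: power2_eq_square)
  \<comment> \<open>Which of the two entries of \<open>E\<close> occurs depends on the pair
    \<open>(i, k)\<close>. Adding both squares covers either case and is the source of the factor
    2.\<close>
  also have "\<dots> \<le> (\<Sum>i\<in>I. \<Sum>k\<in>I. (E i k)\<^sup>2 + (E k i)\<^sup>2)"
    unfolding frob_power2
  proof (intro sum_mono)
    fix i k assume "i \<in> I" "k \<in> I"
    then consider "S i \<subseteq> S k" | "S k \<subseteq> S i" using chain by blast
    thus "(prodT J L L i k)\<^sup>2 \<le> (E i k)\<^sup>2 + (E k i)\<^sup>2"
    proof cases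
      case 1
      hence "prodT J L L i k = E k i"
        by (auto simp: prodT_def E_def L_def trunc_rows_def intro!: sum.cong)
      thus ?thesis by simp
    next
      case 2
      hence "prodT J L L i k = E i k"
        by (auto simp: prodT_def E_def L_def trunc_rows_def intro!: sum.cong)
      thus ?thesis by simp
    qed
  qed
  also have "\<dots> = (frob I I E)\<^sup>2 + (frob I I E)\<^sup>2"
    by (simp add: sum.distrib frob_power2) (rule sum.swap)
  also have "\<dots> \<le> 2 * (s4_norm I J A * s4_norm I J L)\<^sup>2"
    using power_mono[OF frob_prodT_le_s4_norm frob_nonneg, of I I J A L 2]
    by (simp add: E_def)
  finally have *: "(s4_norm I J L)\<^sup>2 * (s4_norm I J L)\<^sup>2 \<le> (sqrt 2 * s4_norm I J A)\<^sup>2 * (s4_norm I J L)\<^sup>2"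
    by (simp add: power_mult_distrib)
  have "s4_norm I J L \<le> sqrt 2 * s4_norm I J A"
  proof (cases "s4_norm I J L = 0")
    case False
    hence "(s4_norm I J L)\<^sup>2 \<le> (sqrt 2 * s4_norm I J A)\<^sup>2"
      using * by (intro mult_right_le_imp_le[OF *]) (simp add: s4_norm_nonneg order_less_le)
    thus ?thesis by (rule power2_le_imp_le) (simp add: s4_norm_nonneg)
  qed (simp add: s4_norm_nonneg)
  thus ?thesis by (simp add: L_def)
qed

text \<open>\<open>|A^T y|^2 = <y, A A^T y>\<close>, and the Frobenius norm of \<open>A A^T\<close>
  bounds its operator norm.\<close>

lemma op_bound_s4_norm: "op_bound J I (transposed A) (s4_norm I J A)"
  unfolding op_bound_def
proof
  fix y
  show "L2_set (\<lambda>l. \<Sum>i\<in>I. transposed A l i * y i) J \<le> s4_norm I J A * L2_set y I"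
  proof (rule power2_le_imp_le)
    have "(L2_set (\<lambda>l. \<Sum>i\<in>I. transposed A l i * y i) J)\<^sup>2 =
        (\<Sum>l\<in>J. \<Sum>i\<in>I. \<Sum>k\<in>I. A i l * y i * (A k l * y k))"
      unfolding L2_set_power2 unfolding transposed_def power2_eq_square sum_product ..
    also have "\<dots> = (\<Sum>i\<in>I. \<Sum>k\<in>I. \<Sum>l\<in>J. A i l * y i * (A k l * y k))"
      by (rule sum_rotate)
    also have "\<dots> = (\<Sum>i\<in>I. y i * (\<Sum>k\<in>I. prodT J A A i k * y k))"
      by (simp add: prodT_def sum_distrib_left sum_distrib_right mult_ac)
    also have "\<dots> \<le> L2_set y I * L2_set (\<lambda>i. \<Sum>k\<in>I. prodT J A A i k * y k) I"
      by (rule inner_le_L2_set)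
    also have "\<dots> \<le> L2_set y I * (frob I I (prodT J A A) * L2_set y I)"
      using op_bound_frob by (intro mult_left_mono) (auto simp: op_bound_def)
    also have "\<dots> = (s4_norm I J A * L2_set y I)\<^sup>2"
      unfolding power_mult_distrib s4_norm_power2 by (simp add: power2_eq_square)
    finally show "(L2_set (\<lambda>l. \<Sum>i\<in>I. transposed A l i * y i) J)\<^sup>2 \<le> (s4_norm I J A * L2_set y I)\<^sup>2" .
  qed (simp add: s4_norm_nonneg)
qed


lemma op_bound_add:
  assumes "op_bound I J A a" "op_bound I J B b"
    and "\<And>i j. i \<in> I \<Longrightarrow> j \<in> J \<Longrightarrow> M i j = A i j + B i j"
  shows "op_bound I J M (a + b)"
  unfolding op_bound_def
proof
  fix x
  have "L2_set (\<lambda>i. \<Sum>j\<in>J. M i j * x j) I =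
      L2_set (\<lambda>i. (\<Sum>j\<in>J. A i j * x j) + (\<Sum>j\<in>J. B i j * x j)) I"
    by (intro L2_set_cong refl) (simp add: assms(3) distrib_right sum.distrib)
  also have "\<dots> \<le> L2_set (\<lambda>i. \<Sum>j\<in>J. A i j * x j) I + L2_set (\<lambda>i. \<Sum>j\<in>J. B i j * x j) I"
    by (rule L2_set_triangle_ineq)
  also have "\<dots> \<le> a * L2_set x J + b * L2_set x J"
    using assms(1,2) by (intro add_mono) (auto simp: op_bound_def)
  finally show "L2_set (\<lambda>i. \<Sum>j\<in>J. M i j * x j) I \<le> (a + b) * L2_set x J"
    by (simp add: distrib_right)
qed

lemma op_bound_mono:
  assumes "op_bound I J A a" "a \<le> b"
  shows "op_bound I J A b"
  using assms unfolding op_bound_def by (meson L2_set_nonneg mult_right_mono order_trans)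

section \<open>Staircase systems\<close>

text \<open>The factor per Richardson step of size \<open>1 / C^2\<close> for an operator with
  singular values between \<open>\<gamma>\<close> and \<open>C\<close>. The spectral value is the
  square of this number; the root is what expanding the squared norm gives directly.\<close>

definition contraction_rate :: "real \<Rightarrow> real \<Rightarrow> real" where
  "contraction_rate C \<gamma> = sqrt (1 - \<gamma>\<^sup>2 / C\<^sup>2)"

lemma contraction_rate_range:
  assumes "0 < \<gamma>" "\<gamma> < C"
  shows "0 < contraction_rate C \<gamma>" "contraction_rate C \<gamma> < 1"
proof -
  have "\<gamma>\<^sup>2 < C\<^sup>2" using assms by (simp add: power_strict_mono)
  thus "0 < contraction_rate C \<gamma>" "contraction_rate C \<gamma> < 1"
    using assms by (auto simp: contraction_rate_def)
qed

text \<open>Row \<open>i\<close> sees only the compression of \<open>A\<close> to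
  \<open>S i\<close>, and \<open>bounded_below\<close> stands for the bound on the inverse of that
  compression. The sets form an arbitrary chain, so that the systems for both triangular factors are
  instances. Strictness in \<open>\<gamma> < C\<close> keeps \<open>q\<close> positive, and later
  estimates divide by \<open>q\<close>.\<close>

locale truncated_system =
  fixes I :: "'a set" and J :: "'b set" and S :: "'a \<Rightarrow> 'b set" and A :: "'b \<Rightarrow> 'b \<Rightarrow> real"
    and C \<gamma> :: real
  assumes chain: "\<And>i k. i \<in> I \<Longrightarrow> k \<in> I \<Longrightarrow> S i \<subseteq> S k \<or> S k \<subseteq> S i"
    and bounded: "op_bound J J A C"
    and \<gamma>_pos: "0 < \<gamma>"
    and \<gamma>_less: "\<gamma> < C"
    and bounded_below: "\<And>i x. i \<in> I \<Longrightarrow> (\<And>l. l \<in> J \<Longrightarrow> l \<notin> S i \<Longrightarrow> x l = 0) \<Longrightarrow>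
       \<gamma> * L2_set x J \<le> L2_set (\<lambda>k. if k \<in> S i then \<Sum>l\<in>J. A k l * x l else 0) J"
begin

abbreviation q :: real where "q \<equiv> contraction_rate C \<gamma>"

text \<open>This is \<open>C^-2 P ((P Y) A)\<close>, the scaled adjoint of
  \<open>N \<mapsto> P (N A^T)\<close> on families supported in the staircase; \<open>prodT\<close>
  with \<open>transposed A\<close> multiplies by \<open>A\<close> itself.\<close>

definition normal_op :: "('a \<Rightarrow> 'b \<Rightarrow> real) \<Rightarrow> 'a \<Rightarrow> 'b \<Rightarrow> real" where
  "normal_op Y = (\<lambda>i l. 1 / C\<^sup>2 * trunc_rows S (prodT J (trunc_rows S Y) (transposed A)) i l)"

text \<open>The subtraction is written as adding a multiple by \<open>-1\<close> to fit
  \<open>s4_norm_triangle\<close> and \<open>s4_norm_scale\<close>.\<close>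

definition step :: "('a \<Rightarrow> 'b \<Rightarrow> real) \<Rightarrow> 'a \<Rightarrow> 'b \<Rightarrow> real" where
  "step N = (\<lambda>i l. N i l + (- 1) * normal_op (prodT J N A) i l)"

lemma C_pos: "0 < C"
  using \<gamma>_pos \<gamma>_less by linarith

lemma bounded_transposed: "op_bound J J (transposed A) C"
  using op_bound_transposed[OF bounded] C_pos by simp

lemmas q_range = contraction_rate_range[OF \<gamma>_pos \<gamma>_less]

text \<open>Let \<open>T\<close> be the compression of \<open>A\<close> to \<open>S i\<close>, so
  \<open>y = T x\<close> and \<open>z = T^T y\<close>. As \<open>x\<close> is supported in
  \<open>S i\<close>, \<open><x, z> = |y|^2\<close>; moreover \<open>|z| \<le> C |y|\<close>.
  Expanding the square leaves at most \<open>|x|^2 - C^-2 |y|^2\<close>, and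
  \<open>|y| \<ge> \<gamma> |x|\<close>.\<close>

lemma row_contraction:
  assumes i: "i \<in> I" and supp: "\<And>l. l \<in> J \<Longrightarrow> l \<notin> S i \<Longrightarrow> x l = 0"
  defines "y \<equiv> (\<lambda>k. if k \<in> S i then \<Sum>l\<in>J. A k l * x l else 0)"
  defines "z \<equiv> (\<lambda>l. if l \<in> S i then \<Sum>k\<in>J. A k l * y k else 0)"
  shows "L2_set (\<lambda>l. x l - 1 / C\<^sup>2 * z l) J \<le> q * L2_set x J"
proof (rule power2_le_imp_le)
  have "L2_set z J \<le> L2_set (\<lambda>l. \<Sum>k\<in>J. transposed A l k * y k) J"
    by (rule L2_set_abs_mono) (auto simp: z_def transposed_def)
  also have "\<dots> \<le> C * L2_set y J"
    using bounded_transposed by (simp add: op_bound_def)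
  finally have "(L2_set z J)\<^sup>2 \<le> (C * L2_set y J)\<^sup>2"
    by (intro power_mono) auto
  hence z: "(L2_set z J)\<^sup>2 \<le> C\<^sup>2 * (L2_set y J)\<^sup>2" by (simp add: power_mult_distrib)
  have "(\<gamma> * L2_set x J)\<^sup>2 \<le> (L2_set y J)\<^sup>2"
    using bounded_below[OF i supp] \<gamma>_pos by (intro power_mono) (auto simp: y_def)
  hence y: "\<gamma>\<^sup>2 * (L2_set x J)\<^sup>2 \<le> (L2_set y J)\<^sup>2" by (simp add: power_mult_distrib)
  have "(\<Sum>l\<in>J. x l * z l) = (\<Sum>l\<in>J. \<Sum>k\<in>J. y k * (A k l * x l))"
    by (intro sum.cong refl) (auto simp: z_def supp sum_distrib_left mult_ac)
  also have "\<dots> = (\<Sum>k\<in>J. y k * (\<Sum>l\<in>J. A k l * x l))"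
    by (subst sum.swap) (simp add: sum_distrib_left)
  also have "\<dots> = (L2_set y J)\<^sup>2"
    unfolding L2_set_power2 by (intro sum.cong refl) (auto simp: y_def power2_eq_square)
  finally have xz: "(\<Sum>l\<in>J. x l * z l) = (L2_set y J)\<^sup>2" .
  have "(L2_set (\<lambda>l. x l - 1 / C\<^sup>2 * z l) J)\<^sup>2 =
      (\<Sum>l\<in>J. (x l)\<^sup>2 - 2 / C\<^sup>2 * (x l * z l) + 1 / C ^ 4 * (z l)\<^sup>2)"
    unfolding L2_set_power2
    by (intro sum.cong refl) (simp add: power2_diff power_divide power_mult_distrib)
  also have "\<dots> = (L2_set x J)\<^sup>2 - 2 / C\<^sup>2 * (L2_set y J)\<^sup>2 + 1 / C ^ 4 * (L2_set z J)\<^sup>2"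
    by (simp add: sum.distrib sum_subtractf sum_distrib_left[symmetric] xz L2_set_power2[of x] L2_set_power2[of z]
        sum_divide_distrib[symmetric])
  also have "\<dots> \<le> (L2_set x J)\<^sup>2 - 2 / C\<^sup>2 * (L2_set y J)\<^sup>2 + 1 / C ^ 4 * (C\<^sup>2 * (L2_set y J)\<^sup>2)"
    using z C_pos by (intro add_left_mono mult_left_mono) auto
  also have "\<dots> = (L2_set x J)\<^sup>2 - 1 / C\<^sup>2 * (L2_set y J)\<^sup>2"
    using C_pos by (simp add: field_simps power2_eq_square power4_eq_xxxx)
  also have "\<dots> \<le> (L2_set x J)\<^sup>2 - 1 / C\<^sup>2 * (\<gamma>\<^sup>2 * (L2_set x J)\<^sup>2)"
    using y C_pos by (intro diff_left_mono mult_left_mono) auto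
  also have "\<dots> = q\<^sup>2 * (L2_set x J)\<^sup>2"
  proof -
    have "\<gamma>\<^sup>2 \<le> C\<^sup>2" using \<gamma>_pos \<gamma>_less by (simp add: power_mono)
    hence "q\<^sup>2 = 1 - \<gamma>\<^sup>2 / C\<^sup>2" using C_pos by (simp add: contraction_rate_def)
    thus ?thesis by (simp add: left_diff_distrib)
  qed
  finally show "(L2_set (\<lambda>l. x l - 1 / C\<^sup>2 * z l) J)\<^sup>2 \<le> (q * L2_set x J)\<^sup>2"
    by (simp add: power_mult_distrib)
qed (use q_range in simp)

lemma frob_step_le:
  assumes "\<And>i l. i \<in> I \<Longrightarrow> l \<in> J \<Longrightarrow> l \<notin> S i \<Longrightarrow> N i l = 0"
  shows "frob I J (step N) \<le> q * frob I J N"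
proof -
  have "frob I J (step N) \<le> L2_set (\<lambda>i. q * L2_set (N i) J) I"
    unfolding frob_def
  proof (rule L2_set_mono)
    fix i assume i: "i \<in> I"
    have "step N i = (\<lambda>l. N i l - 1 / C\<^sup>2 * (if l \<in> S i then \<Sum>k\<in>J. A k l *
        (if k \<in> S i then \<Sum>l\<in>J. A k l * N i l else 0) else 0))"
      by (intro ext) (simp add: step_def normal_op_def trunc_rows_def prodT_def transposed_def mult.commute[of _ "A _ _"] cong: if_cong)
    thus "L2_set (step N i) J \<le> q * L2_set (N i) J"
      using row_contraction[OF i, of "N i"] assms[OF i] by simp
  qed simp
  also have "\<dots> = q * frob I J N"
    using q_range by (simp add: L2_set_scale frob_def)
  finally show ?thesis .
qed

text \<open>Two truncations cost \<open>sqrt 2\<close> each and the multiplication by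
  \<open>A\<close> costs \<open>C\<close>, against the prefactor \<open>1 / C^2\<close>.\<close>

lemma s4_norm_normal_op_le: "s4_norm I J (normal_op Y) \<le> 2 / C * s4_norm I J Y"
proof -
  have "s4_norm I J (normal_op Y) = 1 / C\<^sup>2 * s4_norm I J (trunc_rows S (prodT J (trunc_rows S Y) (transposed A)))"
    unfolding normal_op_def s4_norm_scale by simp
  also have "\<dots> \<le> 1 / C\<^sup>2 * (sqrt 2 * s4_norm I J (prodT J (trunc_rows S Y) (transposed A)))"
    by (intro mult_left_mono s4_norm_trunc_rows_le chain) auto
  also have "\<dots> \<le> 1 / C\<^sup>2 * (sqrt 2 * (C * s4_norm I J (trunc_rows S Y)))"
    using C_pos by (intro mult_left_mono s4_norm_prodT_le bounded_transposed) auto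
  also have "\<dots> \<le> 1 / C\<^sup>2 * (sqrt 2 * (C * (sqrt 2 * s4_norm I J Y)))"
    using C_pos by (intro mult_left_mono s4_norm_trunc_rows_le chain) auto
  also have "\<dots> = 2 / C * s4_norm I J Y"
    using C_pos by (simp add: field_simps power2_eq_square)
  finally show ?thesis .
qed

lemma s4_norm_step_le: "s4_norm I J (step N) \<le> 3 * s4_norm I J N"
proof -
  have "s4_norm I J (step N) \<le> s4_norm I J N + s4_norm I J (\<lambda>i l. (- 1) * normal_op (prodT J N A) i l)"
    unfolding step_def by (rule s4_norm_triangle)
  also have "\<dots> = s4_norm I J N + s4_norm I J (normal_op (prodT J N A))"
    unfolding s4_norm_scale by simp
  also have "\<dots> \<le> s4_norm I J N + 2 / C * (C * s4_norm I J N)"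
    using C_pos
    by (intro add_left_mono order_trans[OF s4_norm_normal_op_le] mult_left_mono s4_norm_prodT_le bounded) auto
  also have "\<dots> = 3 * s4_norm I J N" using C_pos by simp
  finally show ?thesis .
qed

text \<open>The equations of the system hold only inside \<open>S i\<close>. The inner truncation
  discards everything else, which allows \<open>prodT J N A\<close> to be replaced by the right-hand
  side \<open>F\<close>.\<close>

lemma normal_op_cong:
  assumes "\<And>k. k \<in> J \<Longrightarrow> k \<in> S i \<Longrightarrow> Y i k = Z i k"
  shows "normal_op Y i l = normal_op Z i l"
  using assms by (auto simp: normal_op_def trunc_rows_def prodT_def intro!: sum.cong)

lemma normal_op_eq:
  "normal_op Y i l = (if l \<in> S i then (\<Sum>k\<in>J. trunc_rows S Y i k * A k l) / C\<^sup>2 else 0)"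
  by (simp add: normal_op_def prodT_def trunc_rows_def transposed_def)

lemma normal_op_add:
  "normal_op (\<lambda>i k. Y i k + Z i k) i l = normal_op Y i l + normal_op Z i l"
proof -
  have "trunc_rows S (\<lambda>i k. Y i k + Z i k) i k = trunc_rows S Y i k + trunc_rows S Z i k" for k
    by (simp add: trunc_rows_def)
  thus ?thesis
    by (simp add: normal_op_eq distrib_right sum.distrib add_divide_distrib)
qed

lemma step_add:
  assumes "\<And>l. l \<in> J \<Longrightarrow> N i l = H i l + R i l" "l \<in> J"
  shows "step N i l = step H i l + step R i l"
proof -
  have "normal_op (prodT J N A) i l = normal_op (\<lambda>i k. prodT J H A i k + prodT J R A i k) i l"
    by (rule normal_op_cong) (simp add: prodT_def assms distrib_right sum.distrib)
  thus ?thesis by (simp add: step_def normal_op_add assms)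
qed

context
  fixes N F :: "'a \<Rightarrow> 'b \<Rightarrow> real"
  assumes supp: "\<And>i l. i \<in> I \<Longrightarrow> l \<in> J \<Longrightarrow> l \<notin> S i \<Longrightarrow> N i l = 0"
    and solves: "\<And>i k. i \<in> I \<Longrightarrow> k \<in> J \<Longrightarrow> k \<in> S i \<Longrightarrow> (\<Sum>l\<in>J. A k l * N i l) = F i k"
begin

text \<open>A solution satisfies the fixed point equation \<open>N = normal_op F + step N\<close>.
  Inserting a splitting on the right gives the next one: the bound for \<open>H\<close> obeys
  \<open>h \<mapsto> g + 3 h\<close>, which sums to \<open>(3 ^ j - 1) / 2 * g\<close>, while
  \<open>R\<close> keeps its support and contracts by \<open>q\<close>.\<close>

lemma solution_split:
  "\<exists>H R. (\<forall>i\<in>I. \<forall>l\<in>J. N i l = H i l + R i l) \<and> (\<forall>i\<in>I. \<forall>l\<in>J. l \<notin> S i \<longrightarrow> R i l = 0) \<and>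
     s4_norm I J H \<le> (3 ^ j - 1) / 2 * (2 / C * s4_norm I J F) \<and> frob I J R \<le> q ^ j * frob I J N"
proof (induction j)
  case 0
  have "s4_norm I J (\<lambda>i l. 0) = 0"
    using s4_norm_scale[of I J 0 N] by simp
  thus ?case using supp
    by (intro exI[of _ "\<lambda>i l. 0"] exI[of _ N]) simp
next
  case (Suc j)
  define g where "g = 2 / C * s4_norm I J F"
  from Suc obtain H R where HR: "\<And>i l. i \<in> I \<Longrightarrow> l \<in> J \<Longrightarrow> N i l = H i l + R i l"
    and R0: "\<And>i l. i \<in> I \<Longrightarrow> l \<in> J \<Longrightarrow> l \<notin> S i \<Longrightarrow> R i l = 0"
    and H: "s4_norm I J H \<le> (3 ^ j - 1) / 2 * g" and R: "frob I J R \<le> q ^ j * frob I J N"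
    unfolding g_def by metis
  let ?H = "\<lambda>i l. normal_op F i l + step H i l"
  have "N i l = ?H i l + step R i l" if "i \<in> I" "l \<in> J" for i l
  proof -
    have "normal_op (prodT J N A) i l = normal_op F i l"
      by (rule normal_op_cong) (use solves[OF that(1)] in \<open>simp add: prodT_def mult.commute\<close>)
    hence "N i l = normal_op F i l + step N i l" by (simp add: step_def)
    thus ?thesis using step_add[of N i H R l] HR that by simp
  qed
  moreover have "step R i l = 0" if "i \<in> I" "l \<in> J" "l \<notin> S i" for i l
    using that R0 by (simp add: step_def normal_op_def trunc_rows_def)
  moreover have "s4_norm I J ?H \<le> (3 ^ Suc j - 1) / 2 * g"
  proof -
    have "s4_norm I J ?H \<le> g + 3 * ((3 ^ j - 1) / 2 * g)"
      unfolding g_def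
      by (intro order_trans[OF s4_norm_triangle] add_mono s4_norm_normal_op_le
          order_trans[OF s4_norm_step_le] mult_left_mono H[unfolded g_def]) simp
    thus ?thesis by (simp add: field_simps)
  qed
  moreover have "frob I J (step R) \<le> q ^ Suc j * frob I J N"
    using order_trans[OF frob_step_le[OF R0] mult_left_mono[OF R]] q_range by (simp add: mult_ac)
  ultimately show ?case
    unfolding g_def by (intro exI[of _ ?H] exI[of _ "step R"]) simp
qed

lemma frob_solution_le: "frob I J N \<le> frob I J F / \<gamma>"
proof -
  have "\<gamma> * frob I J N = L2_set (\<lambda>i. \<gamma> * L2_set (N i) J) I"
    using \<gamma>_pos by (simp add: L2_set_scale frob_def)
  also have "\<dots> \<le> frob I J F"
    unfolding frob_def
  proof (rule L2_set_mono)
    fix i assume i: "i \<in> I"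
    have "\<gamma> * L2_set (N i) J \<le> L2_set (\<lambda>k. if k \<in> S i then \<Sum>l\<in>J. A k l * N i l else 0) J"
      by (rule bounded_below[OF i supp[OF i]])
    also have "\<dots> \<le> L2_set (F i) J"
      by (rule L2_set_abs_mono) (use solves[OF i] in auto)
    finally show "\<gamma> * L2_set (N i) J \<le> L2_set (F i) J" .
  qed (use \<gamma>_pos in simp)
  finally show ?thesis using \<gamma>_pos by (simp add: field_simps)
qed

text \<open>The operator norm is estimated through \<open>S4\<close> on \<open>H\<close> and through
  the Frobenius norm on \<open>R\<close>. The number \<open>j\<close> of steps stays free, to be
  tuned to the number of rows.\<close>

lemma op_bound_solution:
  "op_bound J I (transposed N) (3 ^ j * (2 / C * s4_norm I J F) + q ^ j * (frob I J F / \<gamma>))"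
proof -
  obtain H R where HR: "\<forall>i\<in>I. \<forall>l\<in>J. N i l = H i l + R i l"
    and H: "s4_norm I J H \<le> (3 ^ j - 1) / 2 * (2 / C * s4_norm I J F)"
    and R: "frob I J R \<le> q ^ j * frob I J N"
    using solution_split by metis
  have "(3 ^ j - 1) / 2 * (2 / C * s4_norm I J F) \<le> 3 ^ j * (2 / C * s4_norm I J F)"
    using C_pos s4_norm_nonneg by (intro mult_right_mono) (auto simp: field_simps)
  hence "s4_norm I J H \<le> 3 ^ j * (2 / C * s4_norm I J F)" using H by linarith
  moreover have "frob I J R \<le> q ^ j * (frob I J F / \<gamma>)"
    using order_trans[OF R mult_left_mono[OF frob_solution_le]] q_range by simp
  moreover have "op_bound J I (transposed N) (s4_norm I J H + frob I J R)"
    by (rule op_bound_add[OF op_bound_s4_norm[of J I H] op_bound_frob[of J I "transposed R", unfolded frob_transposed]])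
       (simp add: transposed_def HR)
  ultimately show ?thesis by (meson op_bound_mono add_mono)
qed

end

end

section \<open>Balancing expansion against contraction\<close>

text \<open>With \<open>j\<close> close to \<open>ln m / (8 ln 3)\<close> the expansion
  \<open>3 ^ j\<close> costs at most \<open>m^(1/8)\<close>, so the first term stays below
  \<open>m^(3/8)\<close>, while \<open>q ^ j\<close> gains a negative power of \<open>m\<close> in
  the second.\<close>

lemma exponent_gain:
  fixes q :: real
  assumes "0 < q" "q < 1"
  obtains e where "0 < e" "e < 1 / 2"
    "\<And>m :: nat. 1 \<le> m \<Longrightarrow> \<exists>j. 3 ^ j * real m powr (1 / 4) \<le> real m powr e \<and>
       q ^ j * real m powr (1 / 2) \<le> 1 / q * real m powr e"
proof
  \<comment> \<open>The first entry guarantees \<open>3 / 8 \<le> 1 / 2 - d\<close>, the second is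
    the exponent gained from \<open>q ^ j\<close>.\<close>
  define d where "d = min (1 / 8) (- ln q / (8 * ln 3))"
  have d: "0 < d" "d \<le> 1 / 8" "d \<le> - ln q / (8 * ln 3)"
    using assms by (auto simp: d_def divide_less_0_iff)
  show "0 < 1 / 2 - d" "1 / 2 - d < 1 / 2" using d by auto
  fix m :: nat assume m: "1 \<le> m"
  define t where "t = ln (real m) / (8 * ln 3)"
  \<comment> \<open>Rounding down keeps the bound on \<open>3 ^ j\<close> and loses at most one
    contraction step, hence the factor \<open>1 / q\<close> in the second estimate.\<close>
  define j where "j = nat \<lfloor>t\<rfloor>"
  have "0 \<le> t" using m by (simp add: t_def)
  hence j: "real j \<le> t" "t - 1 \<le> real j" by (auto simp: j_def)
  have "3 ^ j = exp (real j * ln 3)" by (simp add: exp_of_nat_mult)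
  also have "\<dots> \<le> exp (t * ln 3)" using j by simp
  also have "\<dots> = real m powr (1 / 8)" using m by (simp add: t_def powr_def)
  finally have "3 ^ j * real m powr (1 / 4) \<le> real m powr (1 / 8) * real m powr (1 / 4)"
    by (intro mult_right_mono) auto
  also have "\<dots> = real m powr (1 / 8 + 1 / 4)" by (rule powr_add[symmetric])
  also have "\<dots> \<le> real m powr (1 / 2 - d)" using d m by (intro powr_mono) auto
  finally have 1: "3 ^ j * real m powr (1 / 4) \<le> real m powr (1 / 2 - d)" .
  have "q ^ j = exp (real j * ln q)" using assms by (simp add: exp_of_nat_mult)
  also have "\<dots> \<le> exp ((t - 1) * ln q)" using j assms by simp
  also have "\<dots> = 1 / q * exp (t * ln q)" using assms by (simp add: left_diff_distrib exp_diff)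
  also have "t * ln q = ln q / (8 * ln 3) * ln (real m)" by (simp add: t_def)
  also have "exp \<dots> = real m powr (ln q / (8 * ln 3))" using m by (simp add: powr_def)
  also have "1 / q * \<dots> \<le> 1 / q * real m powr (- d)"
    using d m assms by (intro mult_left_mono powr_mono) auto
  finally have "q ^ j * real m powr (1 / 2) \<le> 1 / q * real m powr (- d) * real m powr (1 / 2)"
    using assms by (intro mult_right_mono) auto
  also have "\<dots> = 1 / q * real m powr (1 / 2 - d)" by (simp add: powr_add[symmetric])
  finally have 2: "q ^ j * real m powr (1 / 2) \<le> 1 / q * real m powr (1 / 2 - d)" .
  show "\<exists>j. 3 ^ j * real m powr (1 / 4) \<le> real m powr (1 / 2 - d) \<and>
       q ^ j * real m powr (1 / 2) \<le> 1 / q * real m powr (1 / 2 - d)"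
    using 1 2 by blast
qed

section \<open>Compositions, inverses and blockwise contraction\<close>

lemma op_bound_compose:
  assumes "op_bound I J A a" "op_bound J K B b" "0 \<le> a"
  shows "op_bound I K (\<lambda>i k. \<Sum>j\<in>J. A i j * B j k) (a * b)"
  unfolding op_bound_def
proof
  fix x
  have "(\<Sum>k\<in>K. (\<Sum>j\<in>J. A i j * B j k) * x k) = (\<Sum>j\<in>J. A i j * (\<Sum>k\<in>K. B j k * x k))" for i
    by (simp add: sum_distrib_left sum_distrib_right mult.assoc) (rule sum.swap)
  hence "L2_set (\<lambda>i. \<Sum>k\<in>K. (\<Sum>j\<in>J. A i j * B j k) * x k) I \<le> a * L2_set (\<lambda>j. \<Sum>k\<in>K. B j k * x k) J"
    using assms(1) by (simp add: op_bound_def)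
  also have "\<dots> \<le> a * (b * L2_set x K)"
    using assms by (intro mult_left_mono) (auto simp: op_bound_def)
  finally show "L2_set (\<lambda>i. \<Sum>k\<in>K. (\<Sum>j\<in>J. A i j * B j k) * x k) I \<le> a * b * L2_set x K"
    by simp
qed

lemma op_bound_cong:
  assumes "op_bound I J A c" "\<And>i j. i \<in> I \<Longrightarrow> j \<in> J \<Longrightarrow> A i j = B i j"
  shows "op_bound I J B c"
proof -
  have "L2_set (\<lambda>i. \<Sum>j\<in>J. A i j * x j) I = L2_set (\<lambda>i. \<Sum>j\<in>J. B i j * x j) I" for x
    by (intro L2_set_cong sum.cong refl) (simp add: assms)
  thus ?thesis using assms(1) by (simp add: op_bound_def)
qed

lemma L2_set_supported:
  assumes "finite J" "R \<subseteq> J" "\<And>l. l \<in> J \<Longrightarrow> l \<notin> R \<Longrightarrow> x l = 0"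
  shows "L2_set x J = L2_set x R"
  unfolding L2_set_def using assms by (intro arg_cong[of _ _ sqrt] sum.mono_neutral_right) auto

text \<open>On \<open>R\<close> the vector is recovered as \<open>x = b (a x)\<close>, so
  \<open>|x| \<le> |a x| / \<gamma>\<close>. The rest is extension by zero from \<open>R\<close> to
  \<open>J\<close>.\<close>

lemma bounded_below_of_left_inverse:
  assumes fin: "finite J" and RJ: "R \<subseteq> J" and b: "op_bound R R b (1 / \<gamma>)" and \<gamma>: "0 < \<gamma>"
    and inv: "\<And>i k. i \<in> R \<Longrightarrow> k \<in> R \<Longrightarrow> (\<Sum>l\<in>R. b i l * a l k) = (if i = k then 1 else 0)"
    and supp: "\<And>l. l \<in> J \<Longrightarrow> l \<notin> R \<Longrightarrow> x l = 0"
  shows "\<gamma> * L2_set x J \<le> L2_set (\<lambda>k. if k \<in> R then \<Sum>l\<in>J. a k l * x l else 0) J"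
proof -
  have finR: "finite R" using RJ fin by (rule finite_subset)
  define y where "y k = (\<Sum>l\<in>R. a k l * x l)" for k
  have "(\<Sum>k\<in>R. b i k * y k) = x i" if "i \<in> R" for i
  proof -
    have "(\<Sum>k\<in>R. b i k * y k) = (\<Sum>l\<in>R. (\<Sum>k\<in>R. b i k * a k l) * x l)"
      unfolding y_def sum_distrib_left sum_distrib_right mult.assoc[symmetric] by (rule sum.swap)
    also have "\<dots> = (\<Sum>l\<in>R. if i = l then x l else 0)"
      by (intro sum.cong refl) (simp add: inv that)
    also have "\<dots> = x i" using that finR by simp
    finally show ?thesis .
  qed
  hence "L2_set x R = L2_set (\<lambda>i. \<Sum>k\<in>R. b i k * y k) R"
    by (intro L2_set_cong) auto
  also have "\<dots> \<le> 1 / \<gamma> * L2_set y R" using b by (simp add: op_bound_def)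
  finally have "\<gamma> * L2_set x R \<le> L2_set y R" using \<gamma> by (simp add: field_simps)
  also have "L2_set x R = L2_set x J"
    using L2_set_supported[OF fin RJ] supp by simp
  also have "L2_set y R = L2_set (\<lambda>k. if k \<in> R then \<Sum>l\<in>J. a k l * x l else 0) R"
  proof (intro L2_set_cong refl)
    fix k assume "k \<in> R"
    moreover have "(\<Sum>l\<in>J. a k l * x l) = y k"
      unfolding y_def using fin RJ supp by (intro sum.mono_neutral_right) auto
    ultimately show "y k = (if k \<in> R then \<Sum>l\<in>J. a k l * x l else 0)" by simp
  qed
  also have "\<dots> = L2_set (\<lambda>k. if k \<in> R then \<Sum>l\<in>J. a k l * x l else 0) J"
    by (rule L2_set_supported[OF fin RJ, symmetric]) simp
  finally show ?thesis .
qed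

text \<open>The norm is at most one rather than equal to one, so that a vector vanishing on some
  block can still be normalized blockwise.\<close>

definition block_family :: "'a set \<Rightarrow> 'b set \<Rightarrow> ('b \<Rightarrow> 'a) \<Rightarrow> ('a \<Rightarrow> 'b \<Rightarrow> real) \<Rightarrow> bool" where
  "block_family I J blk X \<longleftrightarrow>
     (\<forall>a\<in>I. \<forall>k\<in>J. blk k \<noteq> a \<longrightarrow> X a k = 0) \<and> (\<forall>a\<in>I. L2_set (X a) J \<le> 1)"

text \<open>
  Contracting each block with a vector of norm at most one makes the number of blocks, not the
  dimension, the relevant size.
\<close>

lemma op_bound_blockwise:
  assumes fin: "finite I" "finite J" and blk: "\<And>k. k \<in> J \<Longrightarrow> blk k \<in> I"
    and bound: "\<And>X. block_family I J blk X \<Longrightarrow> op_bound K I (\<lambda>l a. \<Sum>k\<in>J. V l k * X a k) c"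
  shows "op_bound K J V c"
  unfolding op_bound_def
proof
  fix z :: "'b \<Rightarrow> real"
  define w where "w a k = (if blk k = a then z k else 0)" for a k
  define s where "s a = L2_set (w a) J" for a
  \<comment> \<open>The family comes from \<open>z\<close> itself, so contracting \<open>V\<close>
    with it and applying the result to the block norms \<open>s\<close> returns \<open>V z\<close>.
    If \<open>s a = 0\<close>, division by zero makes the row zero, which is consistent because
    \<open>w a\<close> then vanishes on \<open>J\<close>.\<close>
  define X where "X a k = w a k / s a" for a k
  have sX: "X a k * s a = w a k" if "k \<in> J" for a k
  proof (cases "s a = 0")
    case True
    hence "w a k = 0" using that fin by (simp add: s_def L2_set_eq_0_iff)
    thus ?thesis by (simp add: X_def)
  qed (simp add: X_def)
  have "L2_set (X a) J \<le> 1" for a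
  proof -
    have "X a = (\<lambda>k. (1 / s a) * w a k)" by (simp add: X_def fun_eq_iff)
    hence "L2_set (X a) J = \<bar>1 / s a\<bar> * s a" by (simp only: L2_set_scale s_def)
    thus ?thesis by (simp add: s_def)
  qed
  hence "block_family I J blk X" by (auto simp: block_family_def X_def w_def)
  hence *: "L2_set (\<lambda>l. \<Sum>a\<in>I. (\<Sum>k\<in>J. V l k * X a k) * s a) K \<le> c * L2_set s I"
    using bound by (simp add: op_bound_def)
  have "(\<Sum>a\<in>I. (\<Sum>k\<in>J. V l k * X a k) * s a) = (\<Sum>k\<in>J. V l k * z k)" for l
  proof -
    have "(\<Sum>a\<in>I. (\<Sum>k\<in>J. V l k * X a k) * s a) = (\<Sum>a\<in>I. \<Sum>k\<in>J. V l k * w a k)"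
      by (simp add: sum_distrib_right mult.assoc sX)
    also have "\<dots> = (\<Sum>k\<in>J. \<Sum>a\<in>I. V l k * w a k)" by (rule sum.swap)
    also have "\<dots> = (\<Sum>k\<in>J. V l k * z k)"
      by (intro sum.cong refl) (simp add: w_def sum_distrib_left[symmetric] fin blk)
    finally show ?thesis .
  qed
  moreover have "L2_set s I = L2_set z J"
  proof (rule power2_eq_imp_eq)
    have "(L2_set s I)\<^sup>2 = (\<Sum>a\<in>I. \<Sum>k\<in>J. (w a k)\<^sup>2)" by (simp add: L2_set_power2 s_def)
    also have "\<dots> = (\<Sum>k\<in>J. \<Sum>a\<in>I. (w a k)\<^sup>2)" by (rule sum.swap)
    also have "\<dots> = (\<Sum>k\<in>J. (z k)\<^sup>2)"
    proof (intro sum.cong refl)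
      fix k assume "k \<in> J"
      have "(\<Sum>a\<in>I. (w a k)\<^sup>2) = (\<Sum>a\<in>I. if blk k = a then (z k)\<^sup>2 else 0)"
        by (intro sum.cong refl) (simp add: w_def)
      thus "(\<Sum>a\<in>I. (w a k)\<^sup>2) = (z k)\<^sup>2" using fin blk[OF \<open>k \<in> J\<close>] by simp
    qed
    finally show "(L2_set s I)\<^sup>2 = (L2_set z J)\<^sup>2" by (simp add: L2_set_power2)
  qed auto
  ultimately show "L2_set (\<lambda>l. \<Sum>k\<in>J. V l k * z k) K \<le> c * L2_set z J" using * by simp
qed

lemma frob_block_family_le:
  assumes "block_family I J blk X"
  shows "frob I J X \<le> real (card I) powr (1 / 2)"
proof -
  have "frob I J X \<le> L2_set (\<lambda>_. 1) I"
    unfolding frob_def using assms by (intro L2_set_mono) (auto simp: block_family_def)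
  thus ?thesis by (simp add: L2_set_def powr_half_sqrt)
qed

text \<open>Rows in different blocks have disjoint supports, so the Gram matrix is diagonal with
  entries at most 1. Its Frobenius norm is at most the root of the number of blocks, and the
  \<open>S4\<close> norm takes one more root.\<close>

lemma s4_norm_block_family_le:
  assumes "block_family I J blk X" "finite I"
  shows "s4_norm I J X \<le> real (card I) powr (1 / 4)"
proof -
  have off: "prodT J X X a c = 0" if "a \<in> I" "c \<in> I" "a \<noteq> c" for a c
    unfolding prodT_def
  proof (rule sum.neutral, rule ballI)
    fix k assume "k \<in> J"
    hence "X a k = 0 \<or> X c k = 0" using assms that unfolding block_family_def by metis
    thus "X a k * X c k = 0" by auto
  qed
  have diag: "\<bar>prodT J X X a a\<bar> \<le> 1" if "a \<in> I" for a
  proof -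
    have "prodT J X X a a = (L2_set (X a) J)\<^sup>2"
      by (simp add: prodT_def L2_set_power2 power2_eq_square[symmetric])
    also have "\<dots> \<le> 1" using assms that by (simp add: block_family_def power_le_one)
    finally show ?thesis using \<open>prodT J X X a a = (L2_set (X a) J)\<^sup>2\<close> by simp
  qed
  have "frob I I (prodT J X X) \<le> frob I I (\<lambda>a c. if a = c then 1 else 0)"
    by (rule frob_abs_mono) (use off diag in auto)
  also have "\<dots> = real (card I) powr (1 / 2)"
  proof -
    have "(frob I I (\<lambda>a c. if a = c then 1 else 0))\<^sup>2 = (\<Sum>a\<in>I. \<Sum>c\<in>I. if a = c then 1 else 0)"
      unfolding frob_power2 by (intro sum.cong refl) simp
    also have "\<dots> = real (card I)" using assms(2) by simp
    finally have "frob I I (\<lambda>a c. if a = c then 1 else 0) = sqrt (real (card I))"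
      using frob_nonneg real_sqrt_unique by metis
    thus ?thesis by (simp add: powr_half_sqrt)
  qed
  finally have "s4_norm I J X \<le> sqrt (real (card I) powr (1 / 2))"
    by (simp add: s4_norm_def)
  thus ?thesis by (simp add: powr_half_sqrt[symmetric] powr_powr)
qed

section \<open>The spectral norm of a matrix\<close>

lemma vec_norm2_eq_L2_set: "vec_norm2 x = L2_set (($) x) {..<dim_vec x}"
  by (simp add: vec_norm2_def L2_set_def)

lemma vec_norm2_mult_mat_vec:
  assumes "A \<in> carrier_mat r c" "x \<in> carrier_vec c"
  shows "vec_norm2 (A *\<^sub>v x) = L2_set (\<lambda>i. \<Sum>j<c. A $$ (i, j) * x $ j) {..<r}"
proof -
  have "vec_norm2 (A *\<^sub>v x) = L2_set (($) (A *\<^sub>v x)) {..<r}"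
    using assms by (simp add: vec_norm2_eq_L2_set)
  also have "\<dots> = L2_set (\<lambda>i. \<Sum>j<c. A $$ (i, j) * x $ j) {..<r}"
    using assms by (intro L2_set_cong refl) (auto simp: scalar_prod_def lessThan_atLeast0 intro!: sum.cong)
  finally show ?thesis .
qed

lemma vec_norm2_mult_mat_vec_le:
  assumes "A \<in> carrier_mat r c" "x \<in> carrier_vec c" "op_bound {..<r} {..<c} (\<lambda>i j. A $$ (i, j)) b"
  shows "vec_norm2 (A *\<^sub>v x) \<le> b * vec_norm2 x"
  using assms unfolding vec_norm2_mult_mat_vec[OF assms(1,2)] by (simp add: vec_norm2_eq_L2_set op_bound_def)

lemma spec_norm_le:
  assumes A: "A \<in> carrier_mat r c" and b: "op_bound {..<r} {..<c} (\<lambda>i j. A $$ (i, j)) b" "0 \<le> b"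
  shows "spec_norm A \<le> b"
  unfolding spec_norm_def
proof (rule cSUP_least)
  have "vec_norm2 (0\<^sub>v (dim_col A)) = 0" by (simp add: vec_norm2_def)
  hence "0\<^sub>v (dim_col A) \<in> {x \<in> carrier_vec (dim_col A). vec_norm2 x \<le> 1}" by simp
  thus "{x \<in> carrier_vec (dim_col A). vec_norm2 x \<le> 1} \<noteq> {}" by blast
  fix x :: "real vec" assume x: "x \<in> {x \<in> carrier_vec (dim_col A). vec_norm2 x \<le> 1}"
  hence "vec_norm2 (A *\<^sub>v x) \<le> b * vec_norm2 x"
    using A b by (intro vec_norm2_mult_mat_vec_le) auto
  also have "\<dots> \<le> b * 1" using x b by (intro mult_left_mono) auto
  finally show "vec_norm2 (A *\<^sub>v x) \<le> b" by simp
qed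

text \<open>Rescaling to a unit vector reduces this to the definition as a supremum. The supremum is
  meaningful because the Frobenius norm bounds the set above.\<close>

lemma op_bound_spec_norm:
  assumes A: "A \<in> carrier_mat r c"
  shows "op_bound {..<r} {..<c} (\<lambda>i j. A $$ (i, j)) (spec_norm A)"
  unfolding op_bound_def
proof
  fix x :: "nat \<Rightarrow> real"
  let ?b = "frob {..<r} {..<c} (\<lambda>i j. A $$ (i, j))"
  define t where "t = L2_set x {..<c}"
  show "L2_set (\<lambda>i. \<Sum>j<c. A $$ (i, j) * x j) {..<r} \<le> spec_norm A * L2_set x {..<c}"
  proof (cases "t = 0")
    case True
    hence "x j = 0" if "j < c" for j using that by (simp add: t_def L2_set_eq_0_iff)
    thus ?thesis using True by (simp add: t_def L2_set_def)
  next
    case False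
    hence t: "t > 0" using L2_set_nonneg[of x] by (simp add: t_def order_less_le)
    define v where "v = vec c (\<lambda>j. (1 / t) * x j)"
    have "vec_norm2 v = L2_set (\<lambda>j. (1 / t) * x j) {..<c}"
      unfolding vec_norm2_eq_L2_set v_def by (intro L2_set_cong) auto
    hence v: "vec_norm2 v = 1" using t by (simp only: L2_set_scale) (simp add: t_def[symmetric])
    have vc: "v \<in> carrier_vec (dim_col A)" using A by (simp add: v_def)
    have "bdd_above ((\<lambda>x. vec_norm2 (A *\<^sub>v x)) ` {x \<in> carrier_vec (dim_col A). vec_norm2 x \<le> 1})"
    proof (rule bdd_aboveI2)
      fix x :: "real vec" assume x: "x \<in> {x \<in> carrier_vec (dim_col A). vec_norm2 x \<le> 1}"
      hence "vec_norm2 (A *\<^sub>v x) \<le> ?b * vec_norm2 x"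
        using A op_bound_frob by (intro vec_norm2_mult_mat_vec_le) auto
      also have "\<dots> \<le> ?b * 1" using x frob_nonneg by (intro mult_left_mono) auto
      finally show "vec_norm2 (A *\<^sub>v x) \<le> ?b" by simp
    qed
    hence "vec_norm2 (A *\<^sub>v v) \<le> spec_norm A"
      unfolding spec_norm_def using v vc by (intro cSUP_upper) auto
    moreover have "vec_norm2 (A *\<^sub>v v) = L2_set (\<lambda>i. (1 / t) * (\<Sum>j<c. A $$ (i, j) * x j)) {..<r}"
      using A vc
      by (subst vec_norm2_mult_mat_vec[of A r c])
         (auto simp: v_def sum_divide_distrib intro!: L2_set_cong sum.cong)
    hence "vec_norm2 (A *\<^sub>v v) = (1 / t) * L2_set (\<lambda>i. \<Sum>j<c. A $$ (i, j) * x j) {..<r}"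
      using t by (simp only: L2_set_scale) simp
    ultimately show ?thesis using t by (simp add: field_simps t_def[symmetric])
  qed
qed


section \<open>Growth of solutions of staircase systems\<close>

text \<open>The constants \<open>e\<close> and \<open>K\<close> are fixed before any system is
  chosen, which gives uniformity in all dimensions. The scale \<open>D\<close> of the right-hand
  side will be 1 for the inverse of \<open>U\<close> and \<open>C\<close> for the inverse of
  \<open>L\<close>.\<close>

lemma truncated_system_growth:
  fixes C \<gamma> :: real
  assumes "0 < \<gamma>" "\<gamma> < C"
  obtains e K where "0 < e" "e < 1 / 2" "0 < K"
    "\<And>(I :: nat set) (J :: nat set) S A N F D.
       \<lbrakk>truncated_system I J S A C \<gamma>; 1 \<le> card I;
        \<And>i l. i \<in> I \<Longrightarrow> l \<in> J \<Longrightarrow> l \<notin> S i \<Longrightarrow> N i l = 0;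
        \<And>i k. i \<in> I \<Longrightarrow> k \<in> J \<Longrightarrow> k \<in> S i \<Longrightarrow> (\<Sum>l\<in>J. A k l * N i l) = F i k;
        0 \<le> D; s4_norm I J F \<le> D * real (card I) powr (1 / 4);
        frob I J F \<le> D * real (card I) powr (1 / 2)\<rbrakk>
       \<Longrightarrow> op_bound J I (transposed N) (D * (K * real (card I) powr e))"
proof -
  define q where "q = contraction_rate C \<gamma>"
  have q: "0 < q" "q < 1" using contraction_rate_range[OF assms] by (auto simp: q_def)
  obtain e where e: "0 < e" "e < 1 / 2" and gain: "\<And>m :: nat. 1 \<le> m \<Longrightarrow>
      \<exists>j. 3 ^ j * real m powr (1 / 4) \<le> real m powr e \<and> q ^ j * real m powr (1 / 2) \<le> 1 / q * real m powr e"
    using exponent_gain[OF q] by blast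
  \<comment> \<open>The summands belong to the \<open>S4\<close> part and to the Frobenius part; the
    latter includes the rounding loss \<open>1 / q\<close>.\<close>
  define K where "K = 2 / C + 1 / (q * \<gamma>)"
  have K: "0 < K" using assms q by (simp add: K_def add_pos_pos)
  show thesis
  proof (rule that[OF e K])
    fix I J :: "nat set" and S A N F and D :: real
    assume sys: "truncated_system I J S A C \<gamma>" and m: "1 \<le> card I"
      and supp: "\<And>i l. i \<in> I \<Longrightarrow> l \<in> J \<Longrightarrow> l \<notin> S i \<Longrightarrow> N i l = 0"
      and solves: "\<And>i k. i \<in> I \<Longrightarrow> k \<in> J \<Longrightarrow> k \<in> S i \<Longrightarrow> (\<Sum>l\<in>J. A k l * N i l) = F i k"
      and D: "0 \<le> D" and F4: "s4_norm I J F \<le> D * real (card I) powr (1 / 4)"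
      and F2: "frob I J F \<le> D * real (card I) powr (1 / 2)"
    let ?m = "real (card I)"
    obtain j where j: "3 ^ j * ?m powr (1 / 4) \<le> ?m powr e" "q ^ j * ?m powr (1 / 2) \<le> 1 / q * ?m powr e"
      using gain[OF m] by blast
    have "op_bound J I (transposed N) (3 ^ j * (2 / C * s4_norm I J F) + q ^ j * (frob I J F / \<gamma>))"
      unfolding q_def by (rule truncated_system.op_bound_solution[OF sys supp solves])
    moreover have "3 ^ j * (2 / C * s4_norm I J F) + q ^ j * (frob I J F / \<gamma>) \<le> D * (K * ?m powr e)"
    proof -
      have "3 ^ j * (2 / C * s4_norm I J F) \<le> 3 ^ j * (2 / C * (D * ?m powr (1 / 4)))"
        using F4 assms by (intro mult_left_mono) auto
      also have "\<dots> = D * (2 / C) * (3 ^ j * ?m powr (1 / 4))" by simp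
      also have "\<dots> \<le> D * (2 / C) * ?m powr e"
        using j D assms by (intro mult_left_mono) auto
      finally have 1: "3 ^ j * (2 / C * s4_norm I J F) \<le> D * (2 / C) * ?m powr e" .
      have "q ^ j * (frob I J F / \<gamma>) \<le> q ^ j * (D * ?m powr (1 / 2) / \<gamma>)"
        using F2 assms q by (intro mult_left_mono divide_right_mono) auto
      also have "\<dots> = D / \<gamma> * (q ^ j * ?m powr (1 / 2))" by simp
      also have "\<dots> \<le> D / \<gamma> * (1 / q * ?m powr e)"
        using j D assms by (intro mult_left_mono) auto
      finally have 2: "q ^ j * (frob I J F / \<gamma>) \<le> D / \<gamma> * (1 / q * ?m powr e)" .
      have "D * (2 / C) * ?m powr e + D / \<gamma> * (1 / q * ?m powr e) = D * (K * ?m powr e)"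
        by (simp add: K_def algebra_simps)
      thus ?thesis using 1 2 by linarith
    qed
    ultimately show "op_bound J I (transposed N) (D * (K * ?m powr e))"
      by (rule op_bound_mono)
  qed
qed

section \<open>The block LU factorization\<close>

text \<open>
  The inverse factors are given by explicit formulas; \<open>V\<close> is \<open>U\<^sup>-\<^sup>1\<close> and \<open>1 - W\<close> is \<open>L\<^sup>-\<^sup>1\<close>. The
  factors themselves are then \<open>M U\<^sup>-\<^sup>1\<close> and \<open>L\<^sup>-\<^sup>1 M\<close>.
\<close>

locale block_lu =
  fixes n m :: nat and ns :: "nat \<Rightarrow> nat" and M :: "real mat" and C \<gamma> :: real and B :: "nat \<Rightarrow> real mat"
  assumes blocks: "block_structure n m ns"
    and M: "M \<in> carrier_mat n n"
    and M_bound: "spec_norm M \<le> C"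
    and \<gamma>_pos: "0 < \<gamma>"
    and \<gamma>_less: "\<gamma> < C"
    and B: "\<And>j. j < m \<Longrightarrow> is_inverse (ns (Suc j)) (lead_block ns M j) (B j)"
    and B_bound: "\<And>j. j < m \<Longrightarrow> spec_norm (B j) \<le> 1 / \<gamma>"
begin

definition blk :: "nat \<Rightarrow> nat" where "blk k = (LEAST a. k < ns (Suc a))"

text \<open>Column \<open>k\<close> is the matching column of the inverse of the leading block
  ending with the block of \<open>k\<close>, padded by zeros.\<close>

definition V :: "nat \<Rightarrow> nat \<Rightarrow> real" where
  "V l k = (if l < ns (Suc (blk k)) then B (blk k) $$ (l, k) else 0)"

text \<open>Row \<open>k\<close> is the part of row \<open>k\<close> of \<open>M\<close> left of its
  diagonal block, times the inverse of the preceding leading block. For the first block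
  \<open>ns 0 = 0\<close> makes the condition false, so the truncated \<open>blk k - 1\<close> is
  never read.\<close>

definition W :: "nat \<Rightarrow> nat \<Rightarrow> real" where
  "W k l = (if l < ns (blk k) then \<Sum>i<ns (blk k). M $$ (k, i) * B (blk k - 1) $$ (i, l) else 0)"

definition Ui :: "real mat" where "Ui = mat n n (\<lambda>(l, k). V l k)"

definition Li :: "real mat" where "Li = mat n n (\<lambda>(k, l). (if k = l then 1 else 0) - W k l)"

definition L :: "real mat" where "L = M * Ui"

definition U :: "real mat" where "U = Li * M"

lemma carriers: "Ui \<in> carrier_mat n n" "Li \<in> carrier_mat n n" "L \<in> carrier_mat n n" "U \<in> carrier_mat n n"
  using M by (auto simp: Ui_def Li_def L_def U_def)

lemma C_pos: "0 < C"
  using \<gamma>_pos \<gamma>_less by linarith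

lemma ns_0: "ns 0 = 0" and ns_m: "ns m = n"
  using blocks by (auto simp: block_structure_def)

lemma ns_mono: "j \<le> m \<Longrightarrow> i \<le> j \<Longrightarrow> ns i \<le> ns j"
proof (induction j)
  case (Suc j)
  have "ns j < ns (Suc j)" using blocks Suc.prems by (auto simp: block_structure_def)
  thus ?case using Suc by (cases "i = Suc j") auto
qed simp

lemma ns_le_n: "j \<le> m \<Longrightarrow> ns j \<le> n"
  using ns_mono[of m j] ns_m by simp

lemma blk:
  assumes "k < n"
  shows "blk k < m" "ns (blk k) \<le> k" "k < ns (Suc (blk k))"
proof -
  have m: "m \<noteq> 0" using assms ns_0 ns_m by (metis not_less_zero)
  hence last: "k < ns (Suc (m - 1))" using assms ns_m by simp
  show "k < ns (Suc (blk k))" unfolding blk_def using last by (rule LeastI)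
  have "blk k \<le> m - 1" unfolding blk_def using last by (rule Least_le)
  thus "blk k < m" using m by simp
  show "ns (blk k) \<le> k"
  proof (cases "blk k")
    case 0
    thus ?thesis using ns_0 by simp
  next
    case (Suc a)
    hence "\<not> k < ns (Suc a)" using not_less_Least[of a "\<lambda>a. k < ns (Suc a)"] by (simp add: blk_def)
    thus ?thesis using Suc by simp
  qed
qed

lemma blk_eq:
  assumes "a < m" "in_block ns a k"
  shows "blk k = a" "k < n"
proof -
  show k: "k < n" using assms ns_le_n[of "Suc a"] by (auto simp: in_block_def)
  have "\<not> a < blk k"
    using ns_mono[of "blk k" "Suc a"] blk[OF k] assms by (auto simp: in_block_def)
  moreover have "\<not> blk k < a"
    using ns_mono[of a "Suc (blk k)"] blk[OF k] assms by (auto simp: in_block_def)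
  ultimately show "blk k = a" by simp
qed

lemma B_inverse:
  assumes "j < m" "i < ns (Suc j)" "k < ns (Suc j)"
  shows "(\<Sum>l<ns (Suc j). M $$ (i, l) * B j $$ (l, k)) = (if i = k then 1 else 0)"
    and "(\<Sum>l<ns (Suc j). B j $$ (i, l) * M $$ (l, k)) = (if i = k then 1 else 0)"
proof -
  let ?r = "ns (Suc j)"
  have Bc: "B j \<in> carrier_mat ?r ?r" and 1: "lead_block ns M j * B j = 1\<^sub>m ?r" and 2: "B j * lead_block ns M j = 1\<^sub>m ?r"
    using B[OF assms(1)] by (auto simp: is_inverse_def)
  have "(lead_block ns M j * B j) $$ (i, k) = (\<Sum>l<ns (Suc j). M $$ (i, l) * B j $$ (l, k))"
    using assms Bc by (auto simp: lead_block_def scalar_prod_def lessThan_atLeast0 intro!: sum.cong)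
  thus "(\<Sum>l<ns (Suc j). M $$ (i, l) * B j $$ (l, k)) = (if i = k then 1 else 0)"
    using 1 assms by simp
  have "(B j * lead_block ns M j) $$ (i, k) = (\<Sum>l<ns (Suc j). B j $$ (i, l) * M $$ (l, k))"
    using assms Bc by (auto simp: lead_block_def scalar_prod_def lessThan_atLeast0 intro!: sum.cong)
  thus "(\<Sum>l<ns (Suc j). B j $$ (i, l) * M $$ (l, k)) = (if i = k then 1 else 0)"
    using 2 assms by simp
qed

lemma M_V:
  assumes "k < n" "i < ns (Suc (blk k))"
  shows "(\<Sum>l<n. M $$ (i, l) * V l k) = (if i = k then 1 else 0)"
proof -
  have "(\<Sum>l<n. M $$ (i, l) * V l k) = (\<Sum>l<ns (Suc (blk k)). M $$ (i, l) * V l k)"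
    using ns_le_n[of "Suc (blk k)"] blk[OF assms(1)]
    by (intro sum.mono_neutral_right) (auto simp: V_def)
  also have "\<dots> = (\<Sum>l<ns (Suc (blk k)). M $$ (i, l) * B (blk k) $$ (l, k))"
    by (intro sum.cong) (auto simp: V_def)
  also have "\<dots> = (if i = k then 1 else 0)"
    using assms blk[OF assms(1)] by (intro B_inverse)
  finally show ?thesis .
qed

text \<open>Left of the diagonal block, \<open>W\<close> reproduces \<open>M\<close>, since
  multiplying by \<open>M\<close> undoes the inverse of the leading block. Thus
  \<open>Li * M = M - W M\<close> vanishes there.\<close>

lemma W_M:
  assumes "i < n" "k < ns (blk i)"
  shows "(\<Sum>l<n. W i l * M $$ (l, k)) = M $$ (i, k)"
proof -
  obtain j where j: "blk i = Suc j" using assms ns_0 by (cases "blk i") auto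
  have jm: "j < m" using blk[OF assms(1)] j by simp
  let ?r = "ns (Suc j)"
  have "(\<Sum>l<n. W i l * M $$ (l, k)) = (\<Sum>l<?r. W i l * M $$ (l, k))"
    using ns_le_n[of "Suc j"] jm by (intro sum.mono_neutral_right) (auto simp: W_def j)
  also have "\<dots> = (\<Sum>l<?r. \<Sum>t<?r. M $$ (i, t) * (B j $$ (t, l) * M $$ (l, k)))"
    by (intro sum.cong refl) (simp add: W_def j sum_distrib_right mult.assoc)
  also have "\<dots> = (\<Sum>t<?r. M $$ (i, t) * (\<Sum>l<?r. B j $$ (t, l) * M $$ (l, k)))"
    by (subst sum.swap) (simp add: sum_distrib_left)
  also have "\<dots> = (\<Sum>t<?r. if t = k then M $$ (i, t) else 0)"
    using assms j jm by (intro sum.cong refl) (auto simp: B_inverse)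
  also have "\<dots> = M $$ (i, k)" using assms j by simp
  finally show ?thesis .
qed

lemma index_mult:
  assumes "P \<in> carrier_mat n n" "Q \<in> carrier_mat n n" "i < n" "k < n"
  shows "(P * Q) $$ (i, k) = (\<Sum>l<n. P $$ (i, l) * Q $$ (l, k))"
  using assms by (auto simp: scalar_prod_def lessThan_atLeast0 intro!: sum.cong)

lemma Ui_index: "l < n \<Longrightarrow> k < n \<Longrightarrow> Ui $$ (l, k) = V l k"
  by (simp add: Ui_def)

lemma Li_index: "k < n \<Longrightarrow> l < n \<Longrightarrow> Li $$ (k, l) = (if k = l then 1 else 0) - W k l"
  by (simp add: Li_def)

lemma Li_mult_index:
  assumes "Q \<in> carrier_mat n n" "i < n" "k < n"
  shows "(Li * Q) $$ (i, k) = Q $$ (i, k) - (\<Sum>l<n. W i l * Q $$ (l, k))"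
proof -
  have "(Li * Q) $$ (i, k) = (\<Sum>l<n. (if i = l then Q $$ (l, k) else 0) - W i l * Q $$ (l, k))"
    using assms carriers by (subst index_mult) (auto intro!: sum.cong simp: Li_index left_diff_distrib)
  thus ?thesis using assms by (simp add: sum_subtractf)
qed

lemma L_index:
  assumes "k < n" "i < ns (Suc (blk k))"
  shows "L $$ (i, k) = (if i = k then 1 else 0)"
proof -
  have "i < n" using assms blk[OF assms(1)] ns_le_n[of "Suc (blk k)"] by simp
  hence "L $$ (i, k) = (\<Sum>l<n. M $$ (i, l) * V l k)"
    using assms M carriers unfolding L_def by (subst index_mult) (auto simp: Ui_index)
  thus ?thesis using M_V[OF assms] by simp
qed

lemma U_index:
  assumes "i < n" "k < ns (blk i)"
  shows "U $$ (i, k) = 0"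
proof -
  have "k < n" using assms blk[OF assms(1)] by simp
  thus ?thesis using assms M W_M[OF assms] unfolding U_def by (simp add: Li_mult_index del: index_mult_mat)
qed

text \<open>
  Both products are \<open>Li * M * Ui\<close>, which is unit block lower triangular when read as \<open>Li * L\<close> and
  block upper triangular when read as \<open>U * Ui\<close>.
\<close>

lemma Li_L: "Li * L = 1\<^sub>m n" and U_Ui: "U * Ui = 1\<^sub>m n"
proof -
  have eq: "Li * L = U * Ui"
    unfolding L_def U_def using M carriers by simp
  have "Li * L = 1\<^sub>m n"
  proof (rule eq_matI)
    fix i k assume "i < dim_row (1\<^sub>m n)" "k < dim_col (1\<^sub>m n)"
    hence ik: "i < n" "k < n" by auto
    have "(Li * L) $$ (i, k) = (if i = k then 1 else 0)"
    proof (cases "blk i \<le> blk k")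
      case True
      have "ns (blk i) \<le> ns (blk k)" "ns (Suc (blk i)) \<le> ns (Suc (blk k))"
        using True blk[OF ik(2)] by (auto intro: ns_mono)
      \<comment> \<open>Row \<open>i\<close> of \<open>W\<close> lives on indices below
        \<open>ns (blk k)\<close>, and there column \<open>k\<close> of \<open>L\<close> is zero: it
        lies above the diagonal block.\<close>
      hence "(\<Sum>l<n. W i l * L $$ (l, k)) = 0"
        using L_index[OF ik(2)] blk[OF ik(2)] by (intro sum.neutral) (force simp: W_def)
      moreover have "L $$ (i, k) = (if i = k then 1 else 0)"
        using L_index[OF ik(2), of i] blk[OF ik(1)] \<open>ns (Suc (blk i)) \<le> _\<close> by simp
      ultimately show ?thesis using ik carriers by (simp add: Li_mult_index del: index_mult_mat)
    next
      case False
      hence le: "ns (Suc (blk k)) \<le> ns (blk i)" using blk[OF ik(1)] by (auto intro: ns_mono)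
      have "U $$ (i, l) * Ui $$ (l, k) = 0" if "l < n" for l
        using U_index[OF ik(1), of l] le that ik by (cases "l < ns (blk i)") (auto simp: Ui_index V_def)
      hence "(U * Ui) $$ (i, k) = 0"
        using ik carriers by (subst index_mult) (auto intro!: sum.neutral)
      thus ?thesis using False eq by auto
    qed
    thus "(Li * L) $$ (i, k) = 1\<^sub>m n $$ (i, k)" using ik by simp
  qed (use carriers in auto)
  thus "Li * L = 1\<^sub>m n" "U * Ui = 1\<^sub>m n" using eq by auto
qed

lemma is_inverse_L: "is_inverse n L Li"
  using carriers Li_L mat_mult_left_right_inverse[OF carriers(2,3) Li_L] by (simp add: is_inverse_def)

lemma is_inverse_U: "is_inverse n U Ui"
  using carriers U_Ui mat_mult_left_right_inverse[OF carriers(4,1) U_Ui] by (simp add: is_inverse_def)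

lemma M_eq: "M = L * U"
proof -
  have "L * U = M * (Ui * U)" unfolding L_def using M carriers by (intro assoc_mult_mat) auto
  also have "\<dots> = M" using is_inverse_U M by (simp add: is_inverse_def)
  finally show ?thesis by simp
qed

lemma unit_block_lower_L: "unit_block_lower m ns L"
  unfolding unit_block_lower_def
proof (intro allI impI)
  fix a b i k assume *: "a < m" "b < m" "in_block ns a i \<and> in_block ns b k"
  have k: "blk k = b" "k < n" and i: "blk i = a" using blk_eq * by auto
  have "L $$ (i, k) = (if i = k then 1 else 0)" if "a \<le> b"
  proof (rule L_index[OF k(2)])
    show "i < ns (Suc (blk k))" using ns_mono[of "Suc b" "Suc a"] that * k by (auto simp: in_block_def)
  qed
  thus "(a < b \<longrightarrow> L $$ (i, k) = 0) \<and> (a = b \<longrightarrow> L $$ (i, k) = (if i = k then 1 else 0))"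
    using i k by auto
qed

lemma block_upper_U: "block_upper m ns U"
  unfolding block_upper_def
proof (intro allI impI)
  fix a b i k assume *: "a < m" "b < m" "in_block ns a i \<and> in_block ns b k" "b < a"
  have i: "blk i = a" "i < n" using blk_eq * by auto
  show "U $$ (i, k) = 0"
    using ns_mono[of a "Suc b"] * i by (intro U_index) (auto simp: in_block_def)
qed

section \<open>Norm bounds for the factors and their inverses\<close>

lemma op_bound_M: "op_bound {..<n} {..<n} (\<lambda>i j. M $$ (i, j)) C"
  using op_bound_mono[OF op_bound_spec_norm[OF M] M_bound] .

lemma op_bound_B: "j < m \<Longrightarrow> op_bound {..<ns (Suc j)} {..<ns (Suc j)} (\<lambda>i k. B j $$ (i, k)) (1 / \<gamma>)"
  using op_bound_mono[OF op_bound_spec_norm B_bound] B by (simp add: is_inverse_def)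

lemma system_Ui:
  "truncated_system {..<m} {..<n} (\<lambda>a. {..<ns (Suc a)}) (\<lambda>i j. M $$ (i, j)) C \<gamma>"
proof
  fix a and x :: "nat \<Rightarrow> real"
  assume a: "a \<in> {..<m}" and supp: "\<And>l. l \<in> {..<n} \<Longrightarrow> l \<notin> {..<ns (Suc a)} \<Longrightarrow> x l = 0"
  show "\<gamma> * L2_set x {..<n} \<le> L2_set (\<lambda>k. if k \<in> {..<ns (Suc a)} then \<Sum>l<n. M $$ (k, l) * x l else 0) {..<n}"
    using a ns_le_n[of "Suc a"] supp
    by (intro bounded_below_of_left_inverse[where b = "\<lambda>i k. B a $$ (i, k)"] op_bound_B \<gamma>_pos B_inverse) auto
qed (use op_bound_M \<gamma>_pos \<gamma>_less in auto)

text \<open>The sets use \<open>ns a\<close>, not \<open>ns (Suc a)\<close>, because block row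
  \<open>a\<close> of \<open>W\<close> ends strictly before its diagonal block. Transposing turns
  the right inverse of a leading block into a left inverse.\<close>

lemma system_Li:
  "truncated_system {..<m} {..<n} (\<lambda>a. {..<ns a}) (transposed (\<lambda>i j. M $$ (i, j))) C \<gamma>"
proof
  fix a and x :: "nat \<Rightarrow> real"
  assume a: "a \<in> {..<m}" and supp: "\<And>l. l \<in> {..<n} \<Longrightarrow> l \<notin> {..<ns a} \<Longrightarrow> x l = 0"
  let ?M = "transposed (\<lambda>i j. M $$ (i, j))"
  show "\<gamma> * L2_set x {..<n} \<le> L2_set (\<lambda>k. if k \<in> {..<ns a} then \<Sum>l<n. ?M k l * x l else 0) {..<n}"
  proof (cases a)
    case 0
    \<comment> \<open>The set of the first block is empty, so \<open>x\<close> vanishes and the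
      estimate is trivial.\<close>
    hence "L2_set x {..<n} = 0" using supp ns_0 by (simp add: L2_set_eq_0_iff)
    thus ?thesis by simp
  next
    case (Suc j)
    hence j: "j < m" using a by simp
    have "op_bound {..<ns a} {..<ns a} (transposed (\<lambda>i k. B j $$ (i, k))) (1 / \<gamma>)"
      using op_bound_transposed[OF op_bound_B[OF j]] \<gamma>_pos Suc by simp
    moreover have "(\<Sum>l<ns a. transposed (\<lambda>i k. B j $$ (i, k)) i l * ?M l k) = (if i = k then 1 else 0)"
      if "i < ns a" "k < ns a" for i k
      using B_inverse(1)[OF j, of k i] that Suc by (simp add: transposed_def mult.commute)
    ultimately show ?thesis
      using a ns_le_n[of a] supp \<gamma>_pos
      by (intro bounded_below_of_left_inverse[where b = "transposed (\<lambda>i k. B j $$ (i, k))"]) auto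
  qed
next
  fix i k show "{..<ns i} \<subseteq> {..<ns k} \<or> {..<ns k} \<subseteq> {..<ns i}" by auto
next
  show "op_bound {..<n} {..<n} (transposed (\<lambda>i j. M $$ (i, j))) C"
    using op_bound_transposed[OF op_bound_M] C_pos by simp
qed (use \<gamma>_pos \<gamma>_less in auto)

text \<open>Contracting the columns of \<open>V\<close> in block \<open>a\<close> with
  \<open>X a\<close> gives a vector solving the leading system with right-hand side
  \<open>X a\<close>, by \<open>M_V\<close>. Hence the staircase estimate applies with
  \<open>F = X\<close>.\<close>

lemma op_bound_V:
  assumes growth: "\<And>N F. \<lbrakk>\<And>a l. a < m \<Longrightarrow> l < n \<Longrightarrow> \<not> l < ns (Suc a) \<Longrightarrow> N a l = 0;
      \<And>a k. a < m \<Longrightarrow> k < n \<Longrightarrow> k < ns (Suc a) \<Longrightarrow> (\<Sum>l<n. M $$ (k, l) * N a l) = F a k;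
      s4_norm {..<m} {..<n} F \<le> real m powr (1 / 4); frob {..<m} {..<n} F \<le> real m powr (1 / 2)\<rbrakk>
      \<Longrightarrow> op_bound {..<n} {..<m} (transposed N) c"
  shows "op_bound {..<n} {..<n} V c"
proof (rule op_bound_blockwise[where I = "{..<m}" and blk = blk])
  fix X assume X: "block_family {..<m} {..<n} blk X"
  define N where "N a l = (\<Sum>k<n. V l k * X a k)" for a l
  have X0: "X a k = 0" if "a < m" "k < n" "blk k \<noteq> a" for a k
    using X that by (simp add: block_family_def)
  have "op_bound {..<n} {..<m} (transposed N) c"
  proof (rule growth[where F = X])
    fix a l assume "a < m" "l < n" "\<not> l < ns (Suc a)"
    thus "N a l = 0"
      unfolding N_def using X0 by (intro sum.neutral) (force simp: V_def)
  next
    fix a i assume a: "a < m" and i: "i < n" "i < ns (Suc a)"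
    have "(\<Sum>l<n. M $$ (i, l) * N a l) = (\<Sum>k<n. (\<Sum>l<n. M $$ (i, l) * V l k) * X a k)"
      unfolding N_def sum_distrib_left sum_distrib_right mult.assoc[symmetric] by (rule sum.swap)
    also have "\<dots> = (\<Sum>k<n. if i = k then X a k else 0)"
    proof (intro sum.cong refl)
      fix k assume "k \<in> {..<n}"
      thus "(\<Sum>l<n. M $$ (i, l) * V l k) * X a k = (if i = k then X a k else 0)"
        using X0[OF a, of k] M_V[of k i] i by (cases "blk k = a") auto
    qed
    also have "\<dots> = X a i" using i by simp
    finally show "(\<Sum>l<n. M $$ (i, l) * N a l) = X a i" .
  qed (use s4_norm_block_family_le[OF X] frob_block_family_le[OF X] in auto)
  thus "op_bound {..<n} {..<m} (\<lambda>l a. \<Sum>k<n. V l k * X a k) c"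
    by (rule op_bound_cong) (simp add: transposed_def N_def)
qed (use blk in auto)

text \<open>The transposed argument: the contracted rows of \<open>W\<close> solve systems with
  \<open>M^T\<close>, and their right-hand side \<open>M^T X a\<close> costs the factor
  \<open>C\<close>.\<close>

lemma op_bound_W:
  assumes growth: "\<And>N F. \<lbrakk>\<And>a l. a < m \<Longrightarrow> l < n \<Longrightarrow> \<not> l < ns a \<Longrightarrow> N a l = 0;
      \<And>a k. a < m \<Longrightarrow> k < n \<Longrightarrow> k < ns a \<Longrightarrow> (\<Sum>l<n. M $$ (l, k) * N a l) = F a k;
      s4_norm {..<m} {..<n} F \<le> C * real m powr (1 / 4); frob {..<m} {..<n} F \<le> C * real m powr (1 / 2)\<rbrakk>
      \<Longrightarrow> op_bound {..<n} {..<m} (transposed N) c"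
  shows "op_bound {..<n} {..<n} (transposed W) c"
proof (rule op_bound_blockwise[where I = "{..<m}" and blk = blk])
  fix X assume X: "block_family {..<m} {..<n} blk X"
  define N where "N a l = (\<Sum>k<n. transposed W l k * X a k)" for a l
  let ?M = "transposed (\<lambda>i j. M $$ (i, j))"
  have M: "op_bound {..<n} {..<n} ?M C" using op_bound_transposed[OF op_bound_M] C_pos by simp
  have X0: "X a k = 0" if "a < m" "k < n" "blk k \<noteq> a" for a k
    using X that by (simp add: block_family_def)
  have "op_bound {..<n} {..<m} (transposed N) c"
  proof (rule growth[where F = "prodT {..<n} X ?M"])
    fix a l assume "a < m" "l < n" "\<not> l < ns a"
    thus "N a l = 0"
      unfolding N_def using X0 by (intro sum.neutral) (force simp: W_def transposed_def)
  next
    fix a i assume a: "a < m" and i: "i < n" "i < ns a"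
    have "(\<Sum>l<n. M $$ (l, i) * N a l) = (\<Sum>k<n. (\<Sum>l<n. W k l * M $$ (l, i)) * X a k)"
      unfolding N_def sum_distrib_left sum_distrib_right transposed_def
      by (subst sum.swap) (simp add: mult_ac)
    also have "\<dots> = (\<Sum>k<n. X a k * ?M i k)"
    proof (intro sum.cong refl)
      fix k assume "k \<in> {..<n}"
      thus "(\<Sum>l<n. W k l * M $$ (l, i)) * X a k = X a k * ?M i k"
        using X0[OF a, of k] W_M[of k i] i by (cases "blk k = a") (auto simp: transposed_def)
    qed
    finally show "(\<Sum>l<n. M $$ (l, i) * N a l) = prodT {..<n} X ?M a i" by (simp add: prodT_def)
  next
    show "s4_norm {..<m} {..<n} (prodT {..<n} X ?M) \<le> C * real m powr (1 / 4)"
      using order_trans[OF s4_norm_prodT_le[OF M] mult_left_mono[OF s4_norm_block_family_le[OF X]]] C_pos by simp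
    show "frob {..<m} {..<n} (prodT {..<n} X ?M) \<le> C * real m powr (1 / 2)"
      using order_trans[OF frob_prodT_le[OF M] mult_left_mono[OF frob_block_family_le[OF X]]] C_pos by simp
  qed
  thus "op_bound {..<n} {..<m} (\<lambda>l a. \<Sum>k<n. transposed W l k * X a k) c"
    by (rule op_bound_cong) (simp add: transposed_def N_def)
qed (use blk in auto)

text \<open>Since \<open>L = M * Ui\<close> and \<open>U = Li * M\<close>, each factor costs
  \<open>C\<close> times the bound for an inverse factor.\<close>

lemma spec_norm_factors_le:
  assumes V: "op_bound {..<n} {..<n} V v" and W: "op_bound {..<n} {..<n} (transposed W) w"
    and nonneg: "0 \<le> v" "0 \<le> w"
  shows "spec_norm L + spec_norm U + spec_norm Li + spec_norm Ui \<le> (C + 1) * (v + w + 1)"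
proof -
  have Ui: "op_bound {..<n} {..<n} (\<lambda>i j. Ui $$ (i, j)) v"
    by (rule op_bound_cong[OF V]) (simp add: Ui_index)
  have one: "op_bound {..<n} {..<n} (\<lambda>i j. if i = j then 1 else 0) 1"
    unfolding op_bound_def
  proof
    fix x :: "nat \<Rightarrow> real"
    have "(\<Sum>j<n. (if i = j then 1 else 0) * x j) = x i" if "i < n" for i
      using that by (simp add: if_distrib[of "\<lambda>c. c * _"] cong: if_cong)
    hence "L2_set (\<lambda>i. \<Sum>j<n. (if i = j then 1 else 0) * x j) {..<n} = L2_set x {..<n}"
      by (intro L2_set_cong) auto
    thus "L2_set (\<lambda>i. \<Sum>j<n. (if i = j then 1 else 0) * x j) {..<n} \<le> 1 * L2_set x {..<n}" by simp
  qed
  have "op_bound {..<n} {..<n} (\<lambda>i j. - W i j) w"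
  proof -
    have "op_bound {..<n} {..<n} W w" using op_bound_transposed[OF W nonneg(2)] by (simp add: transposed_def[abs_def])
    moreover have "L2_set (\<lambda>i. - f i) {..<n} = L2_set f {..<n}" for f :: "nat \<Rightarrow> real"
      by (simp add: L2_set_def)
    ultimately show ?thesis by (simp add: op_bound_def sum_negf)
  qed
  hence Li: "op_bound {..<n} {..<n} (\<lambda>i j. Li $$ (i, j)) (1 + w)"
    by (rule op_bound_add[OF one]) (simp add: Li_index)
  have L: "op_bound {..<n} {..<n} (\<lambda>i j. L $$ (i, j)) (C * v)"
    by (rule op_bound_cong[OF op_bound_compose[OF op_bound_M Ui]])
       (use C_pos M carriers in \<open>auto simp: L_def index_mult simp del: index_mult_mat\<close>)
  have U: "op_bound {..<n} {..<n} (\<lambda>i j. U $$ (i, j)) ((1 + w) * C)"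
    by (rule op_bound_cong[OF op_bound_compose[OF Li op_bound_M]])
       (use nonneg M carriers in \<open>auto simp: U_def index_mult simp del: index_mult_mat\<close>)
  have "spec_norm L + spec_norm U + spec_norm Li + spec_norm Ui \<le> C * v + (1 + w) * C + (1 + w) + v"
    using L U Li Ui carriers nonneg C_pos by (intro add_mono spec_norm_le) auto
  also have "\<dots> = (C + 1) * (v + w + 1)" by (simp add: algebra_simps)
  finally show ?thesis .
qed

end

lemma spec_norm_empty: "A \<in> carrier_mat 0 0 \<Longrightarrow> spec_norm A \<le> 0"
  by (rule spec_norm_le) (auto simp: op_bound_def)

theorem mainTheorem12:
  fixes C \<gamma> :: real
  assumes "C > 0" and "\<gamma> > 0"
  shows "\<exists>C_LU p. C_LU > 0 \<and> p > 2 \<and>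
    (\<forall>n m ns (M :: real mat).
       block_structure n m ns \<longrightarrow> M \<in> carrier_mat n n \<longrightarrow> spec_norm M \<le> C \<longrightarrow>
       (\<forall>j<m. \<exists>B. is_inverse (ns (Suc j)) (lead_block ns M j) B \<and> spec_norm B \<le> 1 / \<gamma>) \<longrightarrow>
       (\<exists>L U Li Ui. L \<in> carrier_mat n n \<and> U \<in> carrier_mat n n \<and> M = L * U \<and>
          unit_block_lower m ns L \<and> block_upper m ns U \<and>
          is_inverse n L Li \<and> is_inverse n U Ui \<and>
          spec_norm L + spec_norm U + spec_norm Li + spec_norm Ui \<le> C_LU * real m powr (1 / p)))"
proof -
  \<comment> \<open>The staircase estimate requires a lower bound strictly below \<open>C\<close>;
    decreasing \<open>\<gamma>\<close> to \<open>g\<close> only weakens the bound on the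
    inverses.\<close>
  define g where "g = min \<gamma> (C / 2)"
  have g: "0 < g" "g < C" "g \<le> \<gamma>" using assms by (auto simp: g_def)
  obtain e K where e: "0 < e" "e < 1 / 2" and K: "0 < K" and growth:
    "\<And>(I :: nat set) (J :: nat set) S A N F D.
       \<lbrakk>truncated_system I J S A C g; 1 \<le> card I;
        \<And>i l. i \<in> I \<Longrightarrow> l \<in> J \<Longrightarrow> l \<notin> S i \<Longrightarrow> N i l = 0;
        \<And>i k. i \<in> I \<Longrightarrow> k \<in> J \<Longrightarrow> k \<in> S i \<Longrightarrow> (\<Sum>l\<in>J. A k l * N i l) = F i k;
        0 \<le> D; s4_norm I J F \<le> D * real (card I) powr (1 / 4);
        frob I J F \<le> D * real (card I) powr (1 / 2)\<rbrakk>
       \<Longrightarrow> op_bound J I (transposed N) (D * (K * real (card I) powr e))"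
    using truncated_system_growth[OF g(1,2)] by blast
  \<comment> \<open>This is \<open>spec_norm_factors_le\<close> with \<open>v = K m^e\<close> and
    \<open>w = C v\<close>, after the summand 1 is absorbed through
    \<open>1 \<le> m^e\<close>.\<close>
  define C_LU where "C_LU = (C + 1) * (K + C * K + 1)"
  show ?thesis
  proof (rule exI[of _ C_LU], rule exI[of _ "1 / e"], intro conjI allI impI)
    show "0 < C_LU" using assms K by (simp add: C_LU_def add_pos_pos)
    show "2 < 1 / e" using e by (simp add: field_simps)
    fix n m ns and M :: "real mat"
    assume blocks: "block_structure n m ns" and M: "M \<in> carrier_mat n n" and M_bound: "spec_norm M \<le> C"
      and inv: "\<forall>j<m. \<exists>B. is_inverse (ns (Suc j)) (lead_block ns M j) B \<and> spec_norm B \<le> 1 / \<gamma>"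
    show "\<exists>L U Li Ui. L \<in> carrier_mat n n \<and> U \<in> carrier_mat n n \<and> M = L * U \<and>
          unit_block_lower m ns L \<and> block_upper m ns U \<and>
          is_inverse n L Li \<and> is_inverse n U Ui \<and>
          spec_norm L + spec_norm U + spec_norm Li + spec_norm Ui \<le> C_LU * real m powr (1 / (1 / e))"
    proof (cases "m = 0")
      \<comment> \<open>Here \<open>0 powr _ = 0\<close> makes the right-hand side zero, so the
        empty matrices must have spectral norm at most zero.\<close>
      case True
      hence n: "n = 0" using blocks by (simp add: block_structure_def)
      have "M = 1\<^sub>m 0 * 1\<^sub>m 0" using M n by (intro eq_matI) auto
      thus ?thesis
        using True n spec_norm_empty[of "1\<^sub>m 0"]
        by (intro exI[of _ "1\<^sub>m 0"])
           (auto simp: unit_block_lower_def block_upper_def is_inverse_def)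
    next
      case False
      from inv obtain B where B: "\<And>j. j < m \<Longrightarrow> is_inverse (ns (Suc j)) (lead_block ns M j) (B j)"
        "\<And>j. j < m \<Longrightarrow> spec_norm (B j) \<le> 1 / \<gamma>" by metis
      have "1 / \<gamma> \<le> 1 / g" using g by (simp add: frac_le)
      then interpret block_lu n m ns M C g B
        using blocks M M_bound g B by unfold_locales (auto intro: order_trans)
      define v where "v = K * real m powr e"
      have v: "0 \<le> v" using K by (simp add: v_def)
      have "op_bound {..<n} {..<n} V v"
      proof (rule op_bound_V)
        fix N F
        assume *: "\<And>a l. a < m \<Longrightarrow> l < n \<Longrightarrow> \<not> l < ns (Suc a) \<Longrightarrow> N a l = 0"
          "\<And>a k. a < m \<Longrightarrow> k < n \<Longrightarrow> k < ns (Suc a) \<Longrightarrow> (\<Sum>l<n. M $$ (k, l) * N a l) = F a k"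
          "s4_norm {..<m} {..<n} F \<le> real m powr (1 / 4)" "frob {..<m} {..<n} F \<le> real m powr (1 / 2)"
        show "op_bound {..<n} {..<m} (transposed N) v"
          using growth[OF system_Ui, of N F 1] * False by (simp add: v_def)
      qed
      moreover have "op_bound {..<n} {..<n} (transposed W) (C * v)"
      proof (rule op_bound_W)
        fix N F
        assume *: "\<And>a l. a < m \<Longrightarrow> l < n \<Longrightarrow> \<not> l < ns a \<Longrightarrow> N a l = 0"
          "\<And>a k. a < m \<Longrightarrow> k < n \<Longrightarrow> k < ns a \<Longrightarrow> (\<Sum>l<n. M $$ (l, k) * N a l) = F a k"
          "s4_norm {..<m} {..<n} F \<le> C * real m powr (1 / 4)" "frob {..<m} {..<n} F \<le> C * real m powr (1 / 2)"
        show "op_bound {..<n} {..<m} (transposed N) (C * v)"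
          using growth[OF system_Li, of N F C] * False C_pos by (simp add: v_def transposed_def[of "\<lambda>i j. M $$ (i, j)"])
      qed
      ultimately have "spec_norm L + spec_norm U + spec_norm Li + spec_norm Ui \<le> (C + 1) * (v + C * v + 1)"
        using v C_pos by (intro spec_norm_factors_le) auto
      also have "\<dots> \<le> (C + 1) * (v + C * v + real m powr e)"
        using C_pos False e by (intro mult_left_mono add_left_mono ge_one_powr_ge_zero) auto
      also have "\<dots> = C_LU * real m powr (1 / (1 / e))"
        by (simp add: C_LU_def v_def algebra_simps)
      finally show ?thesis
        using carriers M_eq unit_block_lower_L block_upper_U is_inverse_L is_inverse_U by blast
    qed
  qed
qed

end
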